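(* Let $\star\in\{{\rm ABS},{\rm NOR}\}$. For all $d\in\mathbb{N}$ and $\varepsilon\in(0,1)$, $$n^{\rm ran,\star}(\varepsilon,d;\Lambda^{\rm std})\le 96\sqrt2\,\Big(n^{\rm wor,\star}\big(\tfrac{\varepsilon}{4},d;\Lambda^{\rm all}\big)+1\Big)\Big(\ln\big(n^{\rm wor,\star}(\tfrac{\varepsilon}{4},d;\Lambda^{\rm all})+1\big)+\ln(192\sqrt2)\Big).$$ Furthermore, for all sufficiently small $\delta>0$ (that is, there is an absolute constant $\delta_0\in(0,1)$ such that for all $\delta\in(0,\delta_0)$) and for all $d\in\mathbb{N}$, $\varepsilon\in(0,1)$, $$n^{\rm ran,\star}(\varepsilon,d;\Lambda^{\rm std})\le 48\Big(4\big(\ln48+\ln\ln\tfrac1\delta+\ln\big(n^{\rm wor,\star}(\tfrac{\varepsilon}{A_\delta},d;\Lambda^{\rm all})+1\big)\big)+\ln\tfrac1\delta\Big)\Big(n^{\rm wor,\star}(\tfrac{\varepsilon}{A_\delta},d;\Lambda^{\rm all})+1\Big),$$ where $A_\delta:=\Big(1+\frac{1}{12\ln\frac1\delta}\Big)^{\frac12}\frac{1}{\sqrt{1-\delta}}$.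
   Context: Setting. For each $d\in\mathbb{N}$, $D_d\subset\mathbb{R}^d$ is a Borel measurable set of positive Lebesgue measure, $\rho_d$ is a probability density function on $D_d$, $G_d=L_2(D_d,\rho_d(x)\,dx)$, and $F_d$ is a separable Hilbert space of functions on $D_d$ that is compactly embedded in $G_d$; ${\rm APP}_d:F_d\to G_d$, ${\rm APP}_d f=f$, is the compact embedding operator. Information. $\Lambda^{\rm all}$ is the extended class of all linear functionals (not necessarily continuous), and $\Lambda^{\rm std}\subset\Lambda^{\rm all}$ is the extended class of all function values $f\mapsto f(x)$, $x\in D_d$ (defined only almost everywhere). Worst case setting. Deterministic algorithms have the form $A_{n,d}f=\phi_{n,d}(L_1(f),\dots,L_n(f))$ with linear functionals $L_1,\dots,L_n\in\Lambda^{\rm all}$ and an arbitrary measurable mapping $\phi_{n,d}:\mathbb{R}^n\to G_d$. Define $$e^{\rm wor}(A_{n,d})=\sup_{\|f\|_{F_d}\le1}\|{\rm APP}_d f-A_{n,d}f\|_{G_d},\qquad e^{\rm wor}(n,d;\Lambda^{\rm all})=\inf_{A_{n,d}}e^{\rm wor}(A_{n,d}),$$ the infimum being over all such algorithms. Randomized setting. For $\Lambda\in\{\Lambda^{\rm all},\Lambda^{\rm std}\}$, randomized algorithms have the form $A_{n,d}^\omega(f)=\phi_{n,d,\omega}(L_{1,\omega}(f),\dots,L_{n,\omega}(f))$ with $L_{j,\omega}\in\Lambda$, where $\phi_{n,d,\omega}$ and $L_{j,\omega}$ may be randomly selected according to some probability space $(\Omega,\Sigma,\mathcal P)$; for each fixed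 $\omega$ the algorithm is a deterministic method with cardinality $n=n(f,\omega)$, which may be random and may depend adaptively on the input. Its cardinality is ${\rm Card}(A_{n,d}^\omega)=\sup_{\|f\|_{F_d}\le1}\mathbb{E}_\omega n(f,\omega)$ and its error is $$e^{\rm ran}(A_{n,d}^\omega)=\sup_{\|f\|_{F_d}\le1}\Big(\mathbb{E}_\omega\|{\rm APP}_d f-A_{n,d}^\omega(f)\|_{G_d}^2\Big)^{1/2}.$$ Define $e^{\rm ran}(n,d;\Lambda)=\inf e^{\rm ran}(A_{n,d}^\omega)$, the infimum being over all such algorithms using information from $\Lambda$ with ${\rm Card}(A_{n,d}^\omega)\le n$. Initial error. For $n=0$ the zero algorithm is used, so $e^{\rm ran}(0,d;\Lambda)=e^{\rm wor}(0,d;\Lambda^{\rm all})=\sup_{\|f\|_{F_d}\le1}\|{\rm APP}_d f\|_{G_d}$. Information complexity. For $\diamond\in\{{\rm wor},{\rm ran}\}$ and $\star\in\{{\rm ABS},{\rm NOR}\}$ (absolute, respectively normalized, error criterion), $$n^{\diamond,\star}(\varepsilon,d;\Lambda)=\inf\{n\in\{0,1,2,\dots\}: e^{\diamond}(n,d;\Lambda)\le\varepsilon\,{\rm CRI}_d\},$$ where ${\rm CRI}_d=1$ if $\star={\rm ABS}$, and ${\rm CRI}_d=e^{\diamond}(0,d;\Lambda)$ if $\star={\rm NOR}$. *)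

theory Defs
  imports "HOL-Probability.Probability"
begin

text \<open>
  Points of \<open>\<real>^d\<close> are extensional functions on \<open>{..<d}\<close>, so that \<open>d\<close> is an ordinary number over
  which one can quantify. The measure below is \<open>\<rho>(x) dx\<close> on \<open>D \<subseteq> \<real>^d\<close>.
\<close>

definition lebesgue_pow :: "nat \<Rightarrow> (nat \<Rightarrow> real) measure" where
  "lebesgue_pow d = (\<Pi>\<^sub>M i\<in>{..<d}. lborel)"

definition weighted_measure ::
    "nat \<Rightarrow> (nat \<Rightarrow> real) set \<Rightarrow> ((nat \<Rightarrow> real) \<Rightarrow> real) \<Rightarrow> (nat \<Rightarrow> real) measure" where
  "weighted_measure d D \<rho> = density (restrict_space (lebesgue_pow d) D) (\<lambda>x. ennreal (\<rho> x))"

definition weighted_domain ::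
    "nat \<Rightarrow> (nat \<Rightarrow> real) set \<Rightarrow> ((nat \<Rightarrow> real) \<Rightarrow> real) \<Rightarrow> bool" where
  "weighted_domain d D \<rho> \<longleftrightarrow>
     D \<in> sets (lebesgue_pow d) \<and> 0 < emeasure (lebesgue_pow d) D \<and>
     \<rho> \<in> borel_measurable (restrict_space (lebesgue_pow d) D) \<and> (\<forall>x\<in>D. 0 \<le> \<rho> x) \<and>
     (\<integral>\<^sup>+x. ennreal (\<rho> x) \<partial>restrict_space (lebesgue_pow d) D) = 1"

text \<open>
  The space \<open>L\<^sub>2(M)\<close> is represented by square-integrable functions; equality in \<open>L\<^sub>2(M)\<close> is equality
  almost everywhere. The \<open>\<sigma>\<close>-algebra of \<open>L2_borel\<close> is generated by the sets that are open for the
  \<open>L\<^sub>2\<close> (pseudo-)distance; its (irrelevant) measure is zero.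
\<close>

definition L2 :: "'a measure \<Rightarrow> ('a \<Rightarrow> real) set" where
  "L2 M = {g \<in> borel_measurable M. integrable M (\<lambda>x. (g x)\<^sup>2)}"

definition L2_norm :: "'a measure \<Rightarrow> ('a \<Rightarrow> real) \<Rightarrow> real" where
  "L2_norm M g = sqrt (LINT x|M. (g x)\<^sup>2)"

definition L2_dist :: "'a measure \<Rightarrow> ('a \<Rightarrow> real) \<Rightarrow> ('a \<Rightarrow> real) \<Rightarrow> real" where
  "L2_dist M g h = L2_norm M (\<lambda>x. g x - h x)"

definition L2_open :: "'a measure \<Rightarrow> ('a \<Rightarrow> real) set \<Rightarrow> bool" where
  "L2_open M U \<longleftrightarrow> U \<subseteq> L2 M \<and> (\<forall>g\<in>U. \<exists>r>0. \<forall>h\<in>L2 M. L2_dist M g h < r \<longrightarrow> h \<in> U)"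

definition L2_borel :: "'a measure \<Rightarrow> ('a \<Rightarrow> real) measure" where
  "L2_borel M = sigma (L2 M) {U. L2_open M U}"

text \<open>
  A Hilbert space of functions embedded in \<open>L\<^sub>2(M)\<close> is given by a linear space \<open>F\<close> of functions and
  an inner product \<open>ip\<close>. As function values only have to be defined almost everywhere, elements of
  \<open>F\<close> are identified when they agree almost everywhere (the embedding into \<open>L\<^sub>2(M)\<close> being injective);
  this is the definiteness clause. Hence \<open>F\<close> may consist of genuine functions as well as of all
  representatives of a space of equivalence classes.
\<close>

definition f_norm :: "(('a \<Rightarrow> real) \<Rightarrow> ('a \<Rightarrow> real) \<Rightarrow> real) \<Rightarrow> ('a \<Rightarrow> real) \<Rightarrow> real" where
  "f_norm ip f = sqrt (ip f f)"

definition f_dist ::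
    "(('a \<Rightarrow> real) \<Rightarrow> ('a \<Rightarrow> real) \<Rightarrow> real) \<Rightarrow> ('a \<Rightarrow> real) \<Rightarrow> ('a \<Rightarrow> real) \<Rightarrow> real" where
  "f_dist ip f g = f_norm ip (\<lambda>x. f x - g x)"

definition inner_product_space_of_functions ::
    "'a measure \<Rightarrow> ('a \<Rightarrow> real) set \<Rightarrow> (('a \<Rightarrow> real) \<Rightarrow> ('a \<Rightarrow> real) \<Rightarrow> real) \<Rightarrow> bool" where
  "inner_product_space_of_functions M F ip \<longleftrightarrow>
     (\<lambda>x. 0) \<in> F \<and>
     (\<forall>f\<in>F. \<forall>g\<in>F. \<forall>a b. (\<lambda>x. a * f x + b * g x) \<in> F) \<and>
     (\<forall>f\<in>F. \<forall>g\<in>F. ip f g = ip g f) \<and>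
     (\<forall>f\<in>F. \<forall>g\<in>F. \<forall>h\<in>F. \<forall>a b. ip (\<lambda>x. a * f x + b * g x) h = a * ip f h + b * ip g h) \<and>
     (\<forall>f\<in>F. 0 \<le> ip f f) \<and>
     (\<forall>f\<in>F. ip f f = 0 \<longleftrightarrow> (AE x in M. f x = 0))"

definition complete_space_of_functions ::
    "('a \<Rightarrow> real) set \<Rightarrow> (('a \<Rightarrow> real) \<Rightarrow> ('a \<Rightarrow> real) \<Rightarrow> real) \<Rightarrow> bool" where
  "complete_space_of_functions F ip \<longleftrightarrow>
     (\<forall>s :: nat \<Rightarrow> 'a \<Rightarrow> real.
        range s \<subseteq> F \<and> (\<forall>\<epsilon>>0. \<exists>N. \<forall>m\<ge>N. \<forall>n\<ge>N. f_dist ip (s m) (s n) < \<epsilon>) \<longrightarrow>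
        (\<exists>f\<in>F. (\<lambda>n. f_dist ip (s n) f) \<longlonglongrightarrow> 0))"

definition separable_space_of_functions ::
    "('a \<Rightarrow> real) set \<Rightarrow> (('a \<Rightarrow> real) \<Rightarrow> ('a \<Rightarrow> real) \<Rightarrow> real) \<Rightarrow> bool" where
  "separable_space_of_functions F ip \<longleftrightarrow>
     (\<exists>S\<subseteq>F. countable S \<and> (\<forall>f\<in>F. \<forall>\<epsilon>>0. \<exists>g\<in>S. f_dist ip f g < \<epsilon>))"

text \<open>Compactness of the embedding, in its sequential form.\<close>

definition compactly_embedded ::
    "'a measure \<Rightarrow> ('a \<Rightarrow> real) set \<Rightarrow> (('a \<Rightarrow> real) \<Rightarrow> ('a \<Rightarrow> real) \<Rightarrow> real) \<Rightarrow> bool" where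
  "compactly_embedded M F ip \<longleftrightarrow>
     F \<subseteq> L2 M \<and>
     (\<forall>s :: nat \<Rightarrow> 'a \<Rightarrow> real. range s \<subseteq> F \<and> bounded (range (\<lambda>n. f_norm ip (s n))) \<longrightarrow>
        (\<exists>g\<in>L2 M. \<exists>r :: nat \<Rightarrow> nat. strict_mono r \<and> (\<lambda>n. L2_dist M (s (r n)) g) \<longlonglongrightarrow> 0))"

definition compactly_embedded_Hilbert_space ::
    "'a measure \<Rightarrow> ('a \<Rightarrow> real) set \<Rightarrow> (('a \<Rightarrow> real) \<Rightarrow> ('a \<Rightarrow> real) \<Rightarrow> real) \<Rightarrow> bool" where
  "compactly_embedded_Hilbert_space M F ip \<longleftrightarrow>
     inner_product_space_of_functions M F ip \<and> complete_space_of_functions F ip \<and>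
     separable_space_of_functions F ip \<and> compactly_embedded M F ip"

definition unit_ball ::
    "('a \<Rightarrow> real) set \<Rightarrow> (('a \<Rightarrow> real) \<Rightarrow> ('a \<Rightarrow> real) \<Rightarrow> real) \<Rightarrow> ('a \<Rightarrow> real) set" where
  "unit_ball F ip = {f \<in> F. f_norm ip f \<le> 1}"

definition initial_error ::
    "'a measure \<Rightarrow> ('a \<Rightarrow> real) set \<Rightarrow> (('a \<Rightarrow> real) \<Rightarrow> ('a \<Rightarrow> real) \<Rightarrow> real) \<Rightarrow> ennreal" where
  "initial_error M F ip = (SUP f\<in>unit_ball F ip. ennreal (L2_norm M f))"

text \<open>Information: linear functionals on \<open>F\<close> need not be continuous.\<close>

definition info_all :: "('a \<Rightarrow> real) set \<Rightarrow> (('a \<Rightarrow> real) \<Rightarrow> real) set" where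
  "info_all F = {L. \<forall>f\<in>F. \<forall>g\<in>F. \<forall>a b. L (\<lambda>x. a * f x + b * g x) = a * L f + b * L g}"

definition info_std :: "'a measure \<Rightarrow> (('a \<Rightarrow> real) \<Rightarrow> real) set" where
  "info_std M = {\<lambda>f. f x | x. x \<in> space M}"

definition info_vec ::
    "(nat \<Rightarrow> ('a \<Rightarrow> real) \<Rightarrow> real) \<Rightarrow> nat \<Rightarrow> ('a \<Rightarrow> real) \<Rightarrow> nat \<Rightarrow> real" where
  "info_vec L n f = (\<lambda>j\<in>{..<n}. L j f)"

abbreviation real_pow :: "nat \<Rightarrow> (nat \<Rightarrow> real) measure" where
  "real_pow n \<equiv> (\<Pi>\<^sub>M j\<in>{..<n}. borel)"

text \<open>Worst case setting.\<close>

definition wor_error ::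
    "'a measure \<Rightarrow> ('a \<Rightarrow> real) set \<Rightarrow> (('a \<Rightarrow> real) \<Rightarrow> ('a \<Rightarrow> real) \<Rightarrow> real) \<Rightarrow>
     (('a \<Rightarrow> real) \<Rightarrow> 'a \<Rightarrow> real) \<Rightarrow> ennreal" where
  "wor_error M F ip A = (SUP f\<in>unit_ball F ip. ennreal (L2_dist M f (A f)))"

definition e_wor ::
    "'a measure \<Rightarrow> ('a \<Rightarrow> real) set \<Rightarrow> (('a \<Rightarrow> real) \<Rightarrow> ('a \<Rightarrow> real) \<Rightarrow> real) \<Rightarrow>
     (('a \<Rightarrow> real) \<Rightarrow> real) set \<Rightarrow> nat \<Rightarrow> ennreal" where
  "e_wor M F ip \<Lambda> n =
     (if n = 0 then initial_error M F ip
      else INF (L, \<phi>) \<in> {(L, \<phi>). (\<forall>j<n. L j \<in> \<Lambda>) \<and> \<phi> \<in> measurable (real_pow n) (L2_borel M)}.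
             wor_error M F ip (\<lambda>f. \<phi> (info_vec L n f)))"

text \<open>
  A deterministic method of varying cardinality computes \<open>L\<^sub>1(f), L\<^sub>2(f), \<dots>\<close> until the values
  computed so far tell it to stop (\<open>stops\<close>), and then maps the values to an element of \<open>L\<^sub>2(M)\<close>.
\<close>

record 'a det_method =
  info :: "nat \<Rightarrow> ('a \<Rightarrow> real) \<Rightarrow> real"
  stops :: "nat \<Rightarrow> (nat \<Rightarrow> real) \<Rightarrow> bool"
  output_map :: "nat \<Rightarrow> (nat \<Rightarrow> real) \<Rightarrow> 'a \<Rightarrow> real"

definition cardinality :: "'a det_method \<Rightarrow> ('a \<Rightarrow> real) \<Rightarrow> nat" where
  "cardinality A f = (LEAST n. stops A n (info_vec (info A) n f))"

definition run :: "'a det_method \<Rightarrow> ('a \<Rightarrow> real) \<Rightarrow> 'a \<Rightarrow> real" where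
  "run A f = output_map A (cardinality A f) (info_vec (info A) (cardinality A f) f)"

definition is_det_method ::
    "'a measure \<Rightarrow> ('a \<Rightarrow> real) set \<Rightarrow> (('a \<Rightarrow> real) \<Rightarrow> real) set \<Rightarrow> 'a det_method \<Rightarrow> bool" where
  "is_det_method M F \<Lambda> A \<longleftrightarrow>
     (\<forall>j. info A j \<in> \<Lambda>) \<and>
     (\<forall>n. output_map A n \<in> measurable (real_pow n) (L2_borel M)) \<and>
     (\<forall>f\<in>F. \<exists>n. stops A n (info_vec (info A) n f))"

text \<open>
  A randomized method is a family of deterministic methods indexed by a probability space; the
  measurability conditions say that the expectations in its cardinality and error make sense.
\<close>

definition is_ran_method ::
    "'a measure \<Rightarrow> ('a \<Rightarrow> real) set \<Rightarrow> (('a \<Rightarrow> real) \<Rightarrow> real) set \<Rightarrow>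
     'w measure \<Rightarrow> ('w \<Rightarrow> 'a det_method) \<Rightarrow> bool" where
  "is_ran_method M F \<Lambda> P A \<longleftrightarrow>
     prob_space P \<and> (\<forall>\<omega>\<in>space P. is_det_method M F \<Lambda> (A \<omega>)) \<and>
     (\<forall>f\<in>F. (\<lambda>\<omega>. cardinality (A \<omega>) f) \<in> measurable P (count_space UNIV)) \<and>
     (\<forall>f\<in>F. (\<lambda>\<omega>. L2_dist M f (run (A \<omega>) f)) \<in> borel_measurable P)"

definition ran_card ::
    "('a \<Rightarrow> real) set \<Rightarrow> (('a \<Rightarrow> real) \<Rightarrow> ('a \<Rightarrow> real) \<Rightarrow> real) \<Rightarrow>
     'w measure \<Rightarrow> ('w \<Rightarrow> 'a det_method) \<Rightarrow> ennreal" where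
  "ran_card F ip P A =
     (SUP f\<in>unit_ball F ip. \<integral>\<^sup>+\<omega>. of_nat (cardinality (A \<omega>) f) \<partial>P)"

definition ennreal_sqrt :: "ennreal \<Rightarrow> ennreal" where
  "ennreal_sqrt x = (if x = \<infinity> then \<infinity> else ennreal (sqrt (enn2real x)))"

definition ran_error ::
    "'a measure \<Rightarrow> ('a \<Rightarrow> real) set \<Rightarrow> (('a \<Rightarrow> real) \<Rightarrow> ('a \<Rightarrow> real) \<Rightarrow> real) \<Rightarrow>
     'w measure \<Rightarrow> ('w \<Rightarrow> 'a det_method) \<Rightarrow> ennreal" where
  "ran_error M F ip P A =
     (SUP f\<in>unit_ball F ip.
        ennreal_sqrt (\<integral>\<^sup>+\<omega>. ennreal ((L2_dist M f (run (A \<omega>) f))\<^sup>2) \<partial>P))"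

text \<open>
  A formula cannot quantify over the type of the sample points, so the infimum is taken over
  probability spaces whose points are themselves deterministic methods. This is no restriction:
  any randomized method can be transported to such a space without changing cardinality and error,
  see \<open>e_ran_le\<close> below.
\<close>

definition e_ran ::
    "'a measure \<Rightarrow> ('a \<Rightarrow> real) set \<Rightarrow> (('a \<Rightarrow> real) \<Rightarrow> ('a \<Rightarrow> real) \<Rightarrow> real) \<Rightarrow>
     (('a \<Rightarrow> real) \<Rightarrow> real) set \<Rightarrow> nat \<Rightarrow> ennreal" where
  "e_ran M F ip \<Lambda> n =
     (if n = 0 then initial_error M F ip
      else INF (P, A) \<in> {(P :: 'a det_method measure, A).
                is_ran_method M F \<Lambda> P A \<and> ran_card F ip P A \<le> of_nat n}.
             ran_error M F ip P A)"

lemma e_ran_le: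
  fixes P :: "'w measure" and A :: "'w \<Rightarrow> 'a det_method"
  assumes meth: "is_ran_method M F \<Lambda> P A" and crd: "ran_card F ip P A \<le> of_nat n" and n: "n \<noteq> 0"
  shows "e_ran M F ip \<Lambda> n \<le> ran_error M F ip P A"
proof -
  interpret prob_space P using meth by (simp add: is_ran_method_def)
  define \<A> where "\<A> = {B. B \<subseteq> A ` space P \<and> A -` B \<inter> space P \<in> sets P}"
  have sa: "sigma_algebra (A ` space P) \<A>"
    unfolding sigma_algebra_iff2
  proof (intro conjI ballI allI impI)
    show "\<A> \<subseteq> Pow (A ` space P)" by (auto simp: \<A>_def)
    show "{} \<in> \<A>" by (auto simp: \<A>_def)
    fix B assume "B \<in> \<A>"
    moreover have "A -` (A ` space P - B) \<inter> space P = space P - (A -` B \<inter> space P)" by auto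
    ultimately show "A ` space P - B \<in> \<A>" by (auto simp: \<A>_def)
  next
    fix B :: "nat \<Rightarrow> 'a det_method set" assume B: "range B \<subseteq> \<A>"
    have "A -` (\<Union>i. B i) \<inter> space P = (\<Union>i. A -` B i \<inter> space P)" by auto
    moreover have "(\<Union>i. A -` B i \<inter> space P) \<in> sets P"
      using B by (intro sets.countable_UN) (auto simp: \<A>_def)
    ultimately show "(\<Union>i. B i) \<in> \<A>" using B by (auto simp: \<A>_def)
  qed
  define N where "N = sigma (A ` space P) \<A>"
  have sp: "space N = A ` space P" and st: "sets N = \<A>"
    unfolding N_def using sigma_algebra.sigma_sets_eq[OF sa]
    by (auto simp: \<A>_def space_measure_of_conv sets_measure_of_conv)
  have A: "A \<in> measurable P N"
    by (rule measurableI) (auto simp: sp st \<A>_def)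
  define Q where "Q = distr P N A"
  have meas: "g \<in> measurable Q X" if g: "(\<lambda>\<omega>. g (A \<omega>)) \<in> measurable P X" for g and X :: "'x measure"
  proof (rule measurableI)
    fix a assume "a \<in> space Q"
    then show "g a \<in> space X" using measurable_space[OF g] by (auto simp: Q_def sp)
  next
    fix S assume "S \<in> sets X"
    then have "(\<lambda>\<omega>. g (A \<omega>)) -` S \<inter> space P \<in> sets P" using g by (rule measurable_sets[rotated])
    moreover have "A -` (g -` S \<inter> A ` space P) \<inter> space P = (\<lambda>\<omega>. g (A \<omega>)) -` S \<inter> space P" by auto
    ultimately show "g -` S \<inter> space Q \<in> sets Q" by (auto simp: Q_def sp st \<A>_def)
  qed
  have int: "(\<integral>\<^sup>+a. h a \<partial>Q) = (\<integral>\<^sup>+\<omega>. h (A \<omega>) \<partial>P)"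
    if "(\<lambda>\<omega>. h (A \<omega>)) \<in> borel_measurable P" for h :: "'a det_method \<Rightarrow> ennreal"
    using meas[OF that] unfolding Q_def by (intro nn_integral_distr[OF A]) simp
  have Q: "is_ran_method M F \<Lambda> Q id"
    using meth prob_space_distr[OF A]
    by (auto simp: is_ran_method_def intro!: meas) (auto simp: Q_def sp)
  have c: "ran_card F ip Q id = ran_card F ip P A"
    unfolding ran_card_def
  proof (intro SUP_cong refl)
    fix f assume "f \<in> unit_ball F ip"
    then have "(\<lambda>\<omega>. cardinality (A \<omega>) f) \<in> measurable P (count_space UNIV)"
      using meth by (auto simp: is_ran_method_def unit_ball_def)
    from measurable_compose[OF this, of "of_nat :: nat \<Rightarrow> ennreal" borel]
    show "(\<integral>\<^sup>+\<omega>. of_nat (cardinality (id \<omega>) f) \<partial>Q) = (\<integral>\<^sup>+\<omega>. of_nat (cardinality (A \<omega>) f) \<partial>P)"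
      by (simp add: int)
  qed
  have e: "ran_error M F ip Q id = ran_error M F ip P A"
    unfolding ran_error_def
  proof (intro SUP_cong refl arg_cong[of _ _ ennreal_sqrt])
    fix f assume "f \<in> unit_ball F ip"
    then have "(\<lambda>\<omega>. L2_dist M f (run (A \<omega>) f)) \<in> borel_measurable P"
      using meth by (auto simp: is_ran_method_def unit_ball_def)
    then have "(\<lambda>\<omega>. ennreal ((L2_dist M f (run (A \<omega>) f))\<^sup>2)) \<in> borel_measurable P" by measurable
    then show "(\<integral>\<^sup>+\<omega>. ennreal ((L2_dist M f (run (id \<omega>) f))\<^sup>2) \<partial>Q) =
        (\<integral>\<^sup>+\<omega>. ennreal ((L2_dist M f (run (A \<omega>) f))\<^sup>2) \<partial>P)"
      by (simp add: int)
  qed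
  have "e_ran M F ip \<Lambda> n \<le> ran_error M F ip Q id"
    unfolding e_ran_def using n Q c crd by (auto intro!: INF_lower2[of "(Q, id)"])
  with e show ?thesis by simp
qed

text \<open>
  Information complexity of a sequence \<open>e\<close> of minimal errors; it is \<open>\<infinity>\<close> if the required error is
  never reached.
\<close>

datatype criterion = ABS | NOR

fun cri :: "criterion \<Rightarrow> (nat \<Rightarrow> ennreal) \<Rightarrow> ennreal" where
  "cri ABS e = 1"
| "cri NOR e = e 0"

definition info_complexity :: "criterion \<Rightarrow> (nat \<Rightarrow> ennreal) \<Rightarrow> real \<Rightarrow> enat" where
  "info_complexity crit e \<epsilon> = (INF n\<in>{n. e n \<le> ennreal \<epsilon> * cri crit e}. enat n)"

definition n_wor_all ::
    "'a measure \<Rightarrow> ('a \<Rightarrow> real) set \<Rightarrow> (('a \<Rightarrow> real) \<Rightarrow> ('a \<Rightarrow> real) \<Rightarrow> real) \<Rightarrow>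
     criterion \<Rightarrow> real \<Rightarrow> enat" where
  "n_wor_all M F ip crit \<epsilon> = info_complexity crit (e_wor M F ip (info_all F)) \<epsilon>"

definition n_ran_std ::
    "'a measure \<Rightarrow> ('a \<Rightarrow> real) set \<Rightarrow> (('a \<Rightarrow> real) \<Rightarrow> ('a \<Rightarrow> real) \<Rightarrow> real) \<Rightarrow>
     criterion \<Rightarrow> real \<Rightarrow> enat" where
  "n_ran_std M F ip crit \<epsilon> = info_complexity crit (e_ran M F ip (info_std M)) \<epsilon>"

text \<open>An increasing bound \<open>b(N)\<close>, unbounded in \<open>N\<close>, is read as \<open>\<infinity>\<close> at \<open>N = \<infinity>\<close>.\<close>

definition at_enat :: "(real \<Rightarrow> real) \<Rightarrow> enat \<Rightarrow> ereal" where
  "at_enat b N = (case N of enat n \<Rightarrow> ereal (b (real n)) | \<infinity> \<Rightarrow> \<infinity>)"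

definition A_const :: "real \<Rightarrow> real" where
  "A_const \<delta> = sqrt (1 + 1 / (12 * ln (1 / \<delta>))) * (1 / sqrt (1 - \<delta>))"

text \<open>The standing assumptions, for a family of problems indexed by the dimension.\<close>

definition approximation_problems ::
    "(nat \<Rightarrow> (nat \<Rightarrow> real) set) \<Rightarrow> (nat \<Rightarrow> (nat \<Rightarrow> real) \<Rightarrow> real) \<Rightarrow>
     (nat \<Rightarrow> ((nat \<Rightarrow> real) \<Rightarrow> real) set) \<Rightarrow>
     (nat \<Rightarrow> ((nat \<Rightarrow> real) \<Rightarrow> real) \<Rightarrow> ((nat \<Rightarrow> real) \<Rightarrow> real) \<Rightarrow> real) \<Rightarrow> bool" where
  "approximation_problems D \<rho> F ip \<longleftrightarrow>
     (\<forall>d\<ge>1. weighted_domain d (D d) (\<rho> d) \<and>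
        compactly_embedded_Hilbert_space (weighted_measure d (D d) (\<rho> d)) (F d) (ip d))"

end

theory Submission
  imports Defs
begin

text \<open>
  The proof compares a randomized method with an arbitrary worst case algorithm of cardinality
  \<open>m\<close> and worst case error \<open>e\<close>, in two independent parts.

  Deterministic part. The functions on which all \<open>m\<close> functionals vanish form a subspace \<open>N\<close> of \<open>F\<close>.
  On it the algorithm cannot distinguish \<open>f\<close> from \<open>- f\<close>, so \<open>L\<^sub>2\<close>-norms on \<open>N\<close> are at most \<open>e\<close> times
  \<open>F\<close>-norms; by continuity of the embedding this survives on the closure of \<open>N\<close>. The
  \<open>F\<close>-orthogonal complement of \<open>N\<close> has dimension at most \<open>m\<close>, so up to null functions it is spanned by some
  \<open>L\<^sub>2\<close>-orthonormal \<open>v 0, \<dots>, v (k - 1)\<close> with \<open>k \<le> m\<close>. Hence the residual \<open>r\<close> of the \<open>L\<^sub>2\<close>-projection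
  of \<open>f\<close> onto their span has norm at most \<open>e\<close>, for every \<open>f\<close> in the unit ball
  (\<open>subspace_from_worst_case_algorithm\<close>). The functionals may be discontinuous, and then \<open>N\<close> is not
  closed; this is why the argument passes to its closure.

  Randomized part. It remains to estimate the \<open>k\<close> Fourier coefficients of \<open>f\<close> from function values at
  random points, with a sum of mean square errors that is at most \<open>\<beta>\<close> times the square of the norm of \<open>r\<close>; the mean
  squared error of the method is then at most \<open>1 + \<beta>\<close> times that square. Two devices achieve this.

  \<^item> Volume sampling: if \<open>k\<close> points are drawn with density \<open>(det (v i (x j)))\<^sup>2 / k!\<close> and \<open>f\<close> is
    interpolated at them by Cramer's rule, then \<open>\<beta> = k\<close>. The determinants in the
    denominators cancel against the density, which leaves integrals of squared determinants
    (\<open>volume_sampling\<close>).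
  \<^item> Monte Carlo correction: if an approximation of \<open>f\<close> in the span is available, the coefficients of the
    remaining error are estimated by importance sampling with \<open>N\<close> independent points drawn with
    density proportional to \<open>\<Sum>i<k. (v i)\<^sup>2\<close>. This replaces \<open>\<beta>\<close> by \<open>(k / N) * (1 + \<beta>)\<close>
    (\<open>Monte_Carlo_correction\<close>).

  The first device makes the error independent of the part of \<open>f\<close> in the span, at the price of a factor
  \<open>k\<close>; about \<open>ln (m + 1)\<close> corrections with \<open>N = 3 * m\<close> points then remove this factor and leave
  \<open>\<beta> = 3 / 2\<close>. The total number of points is of order \<open>m * ln (m + 1)\<close>, which gives the first bound because
  \<open>1 + 3 / 2 \<le> 4\<^sup>2\<close>. One more correction with about \<open>30 * m * ln (1 / \<delta>)\<close> points lowers \<open>\<beta>\<close> to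
  \<open>1 / (12 * ln (1 / \<delta>))\<close>, which gives the second one, with \<open>\<delta>0 = exp (- 1)\<close>.
\<close>

section \<open>Semi-inner products on spaces of functions\<close>

text \<open>
  Both the space \<open>F\<close> with its inner product and \<open>L\<^sub>2\<close> consist of genuine functions, and functions that
  agree almost everywhere are not identified. Hence inner products are only positive semidefinite; the
  locale collects what follows from this alone, and is used for both spaces.
\<close>

locale semi_inner =
  fixes S :: "('a \<Rightarrow> real) set" and b :: "('a \<Rightarrow> real) \<Rightarrow> ('a \<Rightarrow> real) \<Rightarrow> real"
  assumes zero_in: "(\<lambda>x. 0) \<in> S"
    and comb_in: "f \<in> S \<Longrightarrow> g \<in> S \<Longrightarrow> (\<lambda>x. s * f x + t * g x) \<in> S"
    and sym: "f \<in> S \<Longrightarrow> g \<in> S \<Longrightarrow> b f g = b g f"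
    and comb: "f \<in> S \<Longrightarrow> g \<in> S \<Longrightarrow> h \<in> S \<Longrightarrow> b (\<lambda>x. s * f x + t * g x) h = s * b f h + t * b g h"
    and nonneg: "f \<in> S \<Longrightarrow> 0 \<le> b f f"
begin

lemma scale_in: "f \<in> S \<Longrightarrow> (\<lambda>x. s * f x) \<in> S"
  using comb_in[of f f s 0] by simp

lemma diff_in: "f \<in> S \<Longrightarrow> g \<in> S \<Longrightarrow> (\<lambda>x. f x - g x) \<in> S"
  using comb_in[of f g 1 "-1"] by simp

lemma scale: "f \<in> S \<Longrightarrow> h \<in> S \<Longrightarrow> b (\<lambda>x. s * f x) h = s * b f h"
  using comb[of f f h s 0] by simp

lemma diff: "f \<in> S \<Longrightarrow> g \<in> S \<Longrightarrow> h \<in> S \<Longrightarrow> b (\<lambda>x. f x - g x) h = b f h - b g h"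
  using comb[of f g h 1 "-1"] by simp

lemma zero_left: "h \<in> S \<Longrightarrow> b (\<lambda>x. 0) h = 0"
  using scale[of h h 0] by simp

lemma scale_scale: "f \<in> S \<Longrightarrow> b (\<lambda>x. s * f x) (\<lambda>x. s * f x) = s\<^sup>2 * b f f"
  by (simp add: scale sym[of f "\<lambda>x. s * f x"] scale_in power2_eq_square)

lemma diff_diff:
  assumes "f \<in> S" "g \<in> S"
  shows "b (\<lambda>x. f x - g x) (\<lambda>x. f x - g x) = b f f - 2 * b f g + b g g"
  using assms diff[of f g "\<lambda>x. f x - g x"] diff[of f g f] diff[of f g g]
  by (simp add: diff_in sym[of f "\<lambda>x. f x - g x"] sym[of g "\<lambda>x. f x - g x"] sym[of g f])

lemma sum_in:
  assumes "finite I" "\<And>i. i \<in> I \<Longrightarrow> u i \<in> S"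
  shows "(\<lambda>x. \<Sum>i\<in>I. c i * u i x) \<in> S"
  using assms
proof (induction I rule: finite_induct)
  case (insert i I)
  then show ?case using comb_in[of "u i" "\<lambda>x. \<Sum>i\<in>I. c i * u i x" "c i" 1] by simp
qed (simp add: zero_in)

lemma sum_left:
  assumes "finite I" "\<And>i. i \<in> I \<Longrightarrow> u i \<in> S" "h \<in> S"
  shows "b (\<lambda>x. \<Sum>i\<in>I. c i * u i x) h = (\<Sum>i\<in>I. c i * b (u i) h)"
  using assms
proof (induction I rule: finite_induct)
  case (insert i I)
  then show ?case using comb[of "u i" "\<lambda>x. \<Sum>i\<in>I. c i * u i x" h "c i" 1]
    by (simp add: sum_in)
qed (simp add: zero_left)

lemma Cauchy_Schwarz:
  assumes f: "f \<in> S" and g: "g \<in> S"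
  shows "(b f g)\<^sup>2 \<le> b f f * b g g"
proof -
  have *: "0 \<le> b f f - 2 * t * b f g + t\<^sup>2 * b g g" for t
    using nonneg[OF diff_in[OF f scale_in[OF g, of t]]]
    by (simp add: diff_diff f g scale_in scale_scale sym[of f "\<lambda>x. t * g x"] scale sym[of g f])
  show ?thesis
  proof (cases "b g g = 0")
    case True
    have "b f g = 0"
    proof (rule ccontr)
      assume "b f g \<noteq> 0"
      then show False using *[of "(b f f + 1) / (2 * b f g)"] True by (simp add: field_simps)
    qed
    then show ?thesis using True by simp
  next
    case False
    then have "0 < b g g" using nonneg[OF g] by simp
    then show ?thesis using *[of "b f g / b g g"] by (simp add: field_simps power2_eq_square)
  qed
qed

lemma abs_le:
  assumes f: "f \<in> S" and g: "g \<in> S"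
  shows "\<bar>b f g\<bar> \<le> sqrt (b f f) * sqrt (b g g)"
  using real_sqrt_le_mono[OF Cauchy_Schwarz[OF f g]] by (simp add: real_sqrt_mult)

lemma norm_diff_le:
  assumes f: "f \<in> S" and g: "g \<in> S"
  shows "\<bar>sqrt (b f f) - sqrt (b g g)\<bar> \<le> sqrt (b (\<lambda>x. f x - g x) (\<lambda>x. f x - g x))"
proof (rule real_le_rsqrt)
  show "\<bar>sqrt (b f f) - sqrt (b g g)\<bar>\<^sup>2 \<le> b (\<lambda>x. f x - g x) (\<lambda>x. f x - g x)"
    using abs_le[OF f g] nonneg[OF f] nonneg[OF g] by (simp add: diff_diff f g power2_diff)
qed

lemma orthonormal_residual:
  fixes k :: nat
  assumes v: "\<And>i. i < k \<Longrightarrow> v i \<in> S"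
    and on: "\<And>i j. i < k \<Longrightarrow> j < k \<Longrightarrow> b (v i) (v j) = (if i = j then 1 else 0)"
    and f: "f \<in> S" and j: "j < k"
  shows "b (\<lambda>x. f x - (\<Sum>i<k. c i * v i x)) (v j) = b f (v j) - c j"
proof -
  have "(\<Sum>i<k. c i * b (v i) (v j)) = c j"
    using on j by (simp add: if_distrib[of "\<lambda>x. _ * x"] cong: if_cong)
  moreover have "(\<lambda>x. \<Sum>i<k. c i * v i x) \<in> S" using v by (intro sum_in) auto
  moreover have "b (\<lambda>x. \<Sum>i<k. c i * v i x) (v j) = (\<Sum>i<k. c i * b (v i) (v j))"
    using v j by (intro sum_left) auto
  ultimately show ?thesis using v f j by (simp add: diff)
qed

text \<open>
  The squared distance of \<open>f\<close> from a combination of an orthonormal system splits into the part that no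
  choice of coefficients can avoid and the square sum of the errors of the coefficients. Through this
  identity, approximating \<open>f\<close> reduces to estimating its coefficients.
\<close>

lemma Pythagoras:
  fixes k :: nat
  assumes v: "\<And>i. i < k \<Longrightarrow> v i \<in> S"
    and on: "\<And>i j. i < k \<Longrightarrow> j < k \<Longrightarrow> b (v i) (v j) = (if i = j then 1 else 0)"
    and f: "f \<in> S"
  shows "b (\<lambda>x. f x - (\<Sum>i<k. c i * v i x)) (\<lambda>x. f x - (\<Sum>i<k. c i * v i x)) =
    b (\<lambda>x. f x - (\<Sum>i<k. b f (v i) * v i x)) (\<lambda>x. f x - (\<Sum>i<k. b f (v i) * v i x)) +
    (\<Sum>i<k. (c i - b f (v i))\<^sup>2)"
proof -
  have *: "b (\<lambda>x. f x - (\<Sum>i<k. c i * v i x)) (\<lambda>x. f x - (\<Sum>i<k. c i * v i x)) =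
    b f f - 2 * (\<Sum>i<k. c i * b f (v i)) + (\<Sum>i<k. (c i)\<^sup>2)" for c
  proof -
    let ?s = "\<lambda>x. \<Sum>i<k. c i * v i x"
    have s: "?s \<in> S" using v by (intro sum_in) auto
    have "b f ?s = (\<Sum>i<k. c i * b f (v i))"
      using v f by (subst sym[OF f s], subst sum_left) (auto intro!: sum.cong simp: sym[of f])
    moreover have "b ?s ?s = (\<Sum>i<k. (c i)\<^sup>2)"
    proof -
      have "b ?s ?s = (\<Sum>i<k. c i * b (v i) ?s)" using v s by (subst sum_left) auto
      also have "\<dots> = (\<Sum>i<k. c i * c i)"
      proof (intro sum.cong refl)
        fix i assume i: "i \<in> {..<k}"
        then have "b (v i) ?s = (\<Sum>j<k. c j * b (v j) (v i))"
          using v s i by (subst sym[of "v i" ?s], simp, simp, intro sum_left) auto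
        also have "\<dots> = c i"
          using i on by (simp add: if_distrib[of "\<lambda>x. _ * x"] cong: if_cong)
        finally show "c i * b (v i) ?s = c i * c i" by simp
      qed
      finally show ?thesis by (simp add: power2_eq_square)
    qed
    ultimately show ?thesis using diff_diff[OF f s] by simp
  qed
  show ?thesis unfolding *
    by (simp add: power2_diff sum.distrib sum_subtractf power2_eq_square sum_distrib_left algebra_simps)
qed

lemma projection_norm_le:
  fixes k :: nat
  assumes v: "\<And>i. i < k \<Longrightarrow> v i \<in> S"
    and on: "\<And>i j. i < k \<Longrightarrow> j < k \<Longrightarrow> b (v i) (v j) = (if i = j then 1 else 0)"
    and f: "f \<in> S"
  shows "b (\<lambda>x. f x - (\<Sum>i<k. b f (v i) * v i x)) (\<lambda>x. f x - (\<Sum>i<k. b f (v i) * v i x)) \<le> b f f"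
  using Pythagoras[where c = "\<lambda>_. 0", OF v on f] sum_nonneg[of "{..<k}" "\<lambda>i. (b f (v i))\<^sup>2"]
  by simp

end

definition L2_inner :: "'a measure \<Rightarrow> ('a \<Rightarrow> real) \<Rightarrow> ('a \<Rightarrow> real) \<Rightarrow> real" where
  "L2_inner M f g = (LINT x|M. f x * g x)"

lemma L2_norm_eq: "L2_norm M f = sqrt (L2_inner M f f)"
  by (simp add: L2_norm_def L2_inner_def power2_eq_square)

lemma L2_norm_power2: "(L2_norm M f)\<^sup>2 = L2_inner M f f"
  by (simp add: L2_norm_eq L2_inner_def)

lemma semi_inner_L2: "semi_inner (L2 M) (L2_inner M)" (is ?A)
  and L2_mult_integrable: "\<lbrakk>f \<in> L2 M; g \<in> L2 M\<rbrakk> \<Longrightarrow> integrable M (\<lambda>x. f x * g x)"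
proof -
  show mult: "integrable M (\<lambda>x. f x * g x)" if "f \<in> L2 M" "g \<in> L2 M" for f g
  proof (rule Bochner_Integration.integrable_bound)
    show "integrable M (\<lambda>x. (f x)\<^sup>2 + (g x)\<^sup>2)" using that by (auto simp: L2_def)
    show "AE x in M. norm (f x * g x) \<le> norm ((f x)\<^sup>2 + (g x)\<^sup>2)"
    proof (intro AE_I2)
      fix x
      show "norm (f x * g x) \<le> norm ((f x)\<^sup>2 + (g x)\<^sup>2)"
        using sum_squares_bound[of "\<bar>f x\<bar>" "\<bar>g x\<bar>"] mult_nonneg_nonneg[of "\<bar>f x\<bar>" "\<bar>g x\<bar>"]
        by (simp add: abs_mult del: mult_nonneg_nonneg)
    qed
  qed (use that in \<open>auto simp: L2_def\<close>)
  show ?A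
    unfolding L2_inner_def
  proof
    fix f g h and s t :: real assume f: "f \<in> L2 M" and g: "g \<in> L2 M"
    have "(\<lambda>x. (s * f x + t * g x)\<^sup>2) = (\<lambda>x. s\<^sup>2 * (f x)\<^sup>2 + t\<^sup>2 * (g x)\<^sup>2 + (2 * s * t) * (f x * g x))"
      by (auto simp: power2_eq_square algebra_simps)
    moreover have "integrable M (\<lambda>x. s\<^sup>2 * (f x)\<^sup>2 + t\<^sup>2 * (g x)\<^sup>2 + (2 * s * t) * (f x * g x))"
      using f g mult[OF f g] by (auto simp: L2_def)
    ultimately show "(\<lambda>x. s * f x + t * g x) \<in> L2 M" using f g by (auto simp: L2_def)
    show "(LINT x|M. f x * g x) = (LINT x|M. g x * f x)" by (simp add: mult.commute)
    show "(LINT x|M. (s * f x + t * g x) * h x) = s * (LINT x|M. f x * h x) + t * (LINT x|M. g x * h x)"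
      if h: "h \<in> L2 M"
      using mult[OF f h] mult[OF g h] by (simp add: ring_distribs mult.assoc)
    show "0 \<le> (LINT x|M. f x * f x)" by simp
  qed (auto simp: L2_def)
qed

section \<open>Orthogonal projection and homogeneous linear systems\<close>

context semi_inner
begin

text \<open>
  The subspace \<open>N\<close> need not be closed, so the projection \<open>p\<close> of \<open>f\<close> is described as the limit of a
  sequence in \<open>N\<close> whose distances from \<open>f\<close> approach the infimum. By the parallelogram law such a
  sequence is a Cauchy sequence.
\<close>

lemma projection_exists:
  assumes N0: "(\<lambda>x. 0) \<in> N" and N: "N \<subseteq> S"
    and Ncomb: "\<And>f g s t. f \<in> N \<Longrightarrow> g \<in> N \<Longrightarrow> (\<lambda>x. s * f x + t * g x) \<in> N"
    and compl: "complete_space_of_functions S b" and f: "f \<in> S"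
  shows "\<exists>p g. p \<in> S \<and> (\<forall>n::nat. g n \<in> N) \<and> (\<lambda>n. f_dist b (g n) p) \<longlonglongrightarrow> 0 \<and>
    (\<forall>h\<in>N. b (\<lambda>x. f x - p x) h = 0)"
proof -
  define q where "q h = b (\<lambda>x. f x - h x) (\<lambda>x. f x - h x)" for h
  define d where "d = (INF h\<in>N. q h)"
  have q0: "0 \<le> q h" if "h \<in> N" for h
    unfolding q_def using that N f by (intro nonneg diff_in) auto
  have bdd: "bdd_below (q ` N)" using q0 by (intro bdd_belowI[of _ 0]) auto
  have dle: "d \<le> q h" if "h \<in> N" for h
    unfolding d_def by (rule cINF_lower[OF bdd that])
  have "\<exists>h\<in>N. q h < d + 1 / real (Suc n)" for n
    using cINF_less_iff[of N q "d + 1 / real (Suc n)"] N0 bdd unfolding d_def by auto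
  then obtain g where gN: "\<And>n. g n \<in> N" and gd: "\<And>n. q (g n) < d + 1 / real (Suc n)" by metis
  have gS: "g n \<in> S" for n using gN N by auto
  \<comment> \<open>parallelogram law, with the midpoint of two nearly optimal elements as a competitor\<close>
  have cauchy: "b (\<lambda>x. g m x - g n x) (\<lambda>x. g m x - g n x) \<le> 2 / real (Suc m) + 2 / real (Suc n)" for m n
  proof -
    let ?u = "\<lambda>x. f x - g m x" and ?w = "\<lambda>x. f x - g n x"
    let ?h = "\<lambda>x. (1/2) * g m x + (1/2) * g n x"
    have u: "?u \<in> S" and w: "?w \<in> S" using f gS by (auto intro: diff_in)
    have h: "?h \<in> N" using Ncomb[OF gN gN] by blast
    have "q ?h = b (\<lambda>x. (1/2) * ?u x + (1/2) * ?w x) (\<lambda>x. (1/2) * ?u x + (1/2) * ?w x)"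
    proof -
      have "(\<lambda>x. f x - ?h x) = (\<lambda>x. (1/2) * ?u x + (1/2) * ?w x)" by (auto simp: algebra_simps)
      then show ?thesis by (simp only: q_def)
    qed
    also have "\<dots> = (b ?u ?u + 2 * b ?u ?w + b ?w ?w) / 4"
      using u w sym[OF u w] by (simp add: comb comb_in sym[of ?u "\<lambda>x. (1/2) * ?u x + (1/2) * ?w x"]
        sym[of ?w "\<lambda>x. (1/2) * ?u x + (1/2) * ?w x"] del: times_divide_eq_left) (simp add: field_simps)
    finally have "4 * d \<le> b ?u ?u + 2 * b ?u ?w + b ?w ?w" using dle[OF h] by simp
    moreover have "b (\<lambda>x. ?w x - ?u x) (\<lambda>x. ?w x - ?u x) = b ?w ?w - 2 * b ?u ?w + b ?u ?u"
      using diff_diff[OF w u] sym[OF u w] by simp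
    moreover have "(\<lambda>x. ?w x - ?u x) = (\<lambda>x. g m x - g n x)" by auto
    moreover have "b ?u ?u < d + 1 / real (Suc m)" "b ?w ?w < d + 1 / real (Suc n)"
      using gd[of m] gd[of n] by (simp_all add: q_def)
    ultimately show ?thesis by simp
  qed
  have "\<exists>N0. \<forall>m\<ge>N0. \<forall>n\<ge>N0. f_dist b (g m) (g n) < \<epsilon>" if "\<epsilon> > 0" for \<epsilon>
  proof -
    obtain N0 where N0: "4 / \<epsilon>\<^sup>2 < real N0" using reals_Archimedean2 by blast
    have "f_dist b (g m) (g n) < \<epsilon>" if m: "m \<ge> N0" and n: "n \<ge> N0" for m n
    proof -
      have le: "2 / real (Suc j) < \<epsilon>\<^sup>2 / 2" if "j \<ge> N0" for j
      proof -
        have "4 / \<epsilon>\<^sup>2 < real (Suc j)" using N0 that by linarith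
        then show ?thesis using \<open>\<epsilon> > 0\<close> by (simp add: field_simps)
      qed
      have "b (\<lambda>x. g m x - g n x) (\<lambda>x. g m x - g n x) < \<epsilon>\<^sup>2"
        using cauchy[of m n] le[OF m] le[OF n] by simp
      then show ?thesis using \<open>\<epsilon> > 0\<close> unfolding f_dist_def f_norm_def
        by (intro real_less_lsqrt) auto
    qed
    then show ?thesis by blast
  qed
  then obtain p where p: "p \<in> S" and lim: "(\<lambda>n. f_dist b (g n) p) \<longlonglongrightarrow> 0"
    using compl gS unfolding complete_space_of_functions_def by blast
  have orth: "b (\<lambda>x. f x - p x) h = 0" if h: "h \<in> N" for h
  proof -
    have hS: "h \<in> S" using h N by auto
    \<comment> \<open>moving from \<open>g n\<close> in the direction \<open>h\<close> gains at most \<open>1 / Suc n\<close>\<close>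
    have opt: "(b (\<lambda>x. f x - g n x) h)\<^sup>2 \<le> b h h / real (Suc n)" for n
    proof -
      let ?u = "\<lambda>x. f x - g n x"
      have u: "?u \<in> S" using f gS by (auto intro: diff_in)
      have *: "0 \<le> 1 / real (Suc n) - 2 * t * b ?u h + t\<^sup>2 * b h h" for t
      proof -
        have "(\<lambda>x. 1 * g n x + t * h x) \<in> N" using Ncomb[OF gN h] by blast
        from dle[OF this] have "d \<le> b (\<lambda>x. ?u x - t * h x) (\<lambda>x. ?u x - t * h x)"
          unfolding q_def by (simp add: algebra_simps)
        also have "\<dots> = b ?u ?u - 2 * t * b ?u h + t\<^sup>2 * b h h"
          using u hS by (simp add: diff_diff scale_in scale_scale sym[of ?u "\<lambda>x. t * h x"] scale sym[of h ?u])
        finally show ?thesis using gd[of n] by (simp add: q_def)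
      qed
      show ?thesis
      proof (cases "b h h = 0")
        case True
        then show ?thesis using Cauchy_Schwarz[OF u hS] by simp
      next
        case False
        then have "0 < b h h" using nonneg[OF hS] by simp
        then have "(b ?u h)\<^sup>2 / b h h \<le> 1 / real (Suc n)"
          using *[of "b ?u h / b h h"] by (simp add: power2_eq_square)
        then show ?thesis using \<open>0 < b h h\<close> by (simp only: pos_divide_le_eq) simp
      qed
    qed
    have lim0: "(\<lambda>n. b h h / real (Suc n)) \<longlonglongrightarrow> 0"
      using lim_const_over_n[of "b h h"] by (rule LIMSEQ_Suc)
    have "(\<lambda>n. (b (\<lambda>x. f x - g n x) h)\<^sup>2) \<longlonglongrightarrow> 0"
      by (rule real_tendsto_sandwich[OF _ _ tendsto_const lim0]; intro always_eventually allI opt zero_le_power2)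
    from tendsto_real_sqrt[OF this] have "(\<lambda>n. b (\<lambda>x. f x - g n x) h) \<longlonglongrightarrow> 0"
      by (simp add: tendsto_rabs_zero_iff)
    moreover have "(\<lambda>n. b (\<lambda>x. g n x - p x) h) \<longlonglongrightarrow> 0"
    proof (rule Lim_null_comparison)
      show "\<forall>\<^sub>F n in sequentially. norm (b (\<lambda>x. g n x - p x) h) \<le> f_dist b (g n) p * sqrt (b h h)"
        using abs_le[OF diff_in[OF gS p] hS] by (simp add: f_dist_def f_norm_def)
      show "(\<lambda>n. f_dist b (g n) p * sqrt (b h h)) \<longlonglongrightarrow> 0" using lim by (intro tendsto_mult_left_zero)
    qed
    ultimately have "(\<lambda>n. b (\<lambda>x. f x - g n x) h + b (\<lambda>x. g n x - p x) h) \<longlonglongrightarrow> 0 + 0" by (rule tendsto_add)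
    moreover have "b (\<lambda>x. f x - g n x) h + b (\<lambda>x. g n x - p x) h = b (\<lambda>x. f x - p x) h" for n
      using f gS p hS by (simp add: diff)
    ultimately show ?thesis by (simp add: tendsto_const_iff)
  qed
  then show ?thesis using p gN lim by blast
qed

end

text \<open>
  Induction on the number of equations, which eliminates one unknown by means of the last equation.
\<close>

lemma homogeneous_system_nontrivial_solution:
  fixes B :: "nat \<Rightarrow> nat \<Rightarrow> real"
  shows "\<exists>a. (\<exists>i\<le>m. a i \<noteq> 0) \<and> (\<forall>j<m. (\<Sum>i\<le>m. a i * B j i) = 0)"
proof (induction m arbitrary: B)
  case 0
  show ?case by (rule exI[of _ "\<lambda>_. 1"]) simp
next
  case (Suc m)
  show ?case
  proof (cases "\<exists>l\<le>Suc m. B m l \<noteq> 0")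
    case False
    \<comment> \<open>the last equation is void\<close>
    obtain a where a: "\<exists>i\<le>m. a i \<noteq> 0" "\<forall>j<m. (\<Sum>i\<le>m. a i * B j i) = 0" using Suc.IH[of B] by blast
    let ?a = "a(Suc m := 0)"
    have "(\<Sum>i\<le>Suc m. ?a i * B j i) = (\<Sum>i\<le>m. a i * B j i)" for j by simp
    moreover have "\<exists>i\<le>Suc m. ?a i \<noteq> 0"
    proof -
      obtain i where "i \<le> m" "a i \<noteq> 0" using a by blast
      then show ?thesis by (intro exI[of _ i]) auto
    qed
    ultimately show ?thesis using a False by (intro exI[of _ ?a]) (auto simp: less_Suc_eq)
  next
    case True
    then obtain l where l: "l \<le> Suc m" "B m l \<noteq> 0" by blast
    \<comment> \<open>eliminate the unknown \<open>l\<close> by means of the last equation; \<open>s\<close> enumerates the others\<close>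
    define s where "s i = (if i < l then i else Suc i)" for i
    have bij: "bij_betw s {..m} ({..Suc m} - {l})"
      by (rule bij_betwI[where g = "\<lambda>i. if i < l then i else i - 1"]) (use l in \<open>auto simp: s_def split: if_splits\<close>)
    define B' where "B' j i = B j (s i) - B m (s i) * B j l / B m l" for j i
    obtain a where a: "\<exists>i\<le>m. a i \<noteq> 0" "\<forall>j<m. (\<Sum>i\<le>m. a i * B' j i) = 0" using Suc.IH[of B'] by blast
    define t where "t = the_inv_into {..m} s"
    have ts: "t (s i) = i" if "i \<le> m" for i
      unfolding t_def using that bij by (intro the_inv_into_f_f) (auto simp: bij_betw_def)
    define a' where "a' i = (if i = l then - (\<Sum>i\<le>m. a i * B m (s i)) / B m l else a (t i))" for i
    have sl: "s i \<noteq> l" for i by (auto simp: s_def)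
    have sum: "(\<Sum>i\<le>Suc m. a' i * B j i) = a' l * B j l + (\<Sum>i\<le>m. a i * B j (s i))" for j
    proof -
      have "(\<Sum>i\<le>Suc m. a' i * B j i) = a' l * B j l + (\<Sum>i\<in>{..Suc m} - {l}. a' i * B j i)"
        using l by (subst sum.remove[of _ l]) auto
      also have "(\<Sum>i\<in>{..Suc m} - {l}. a' i * B j i) = (\<Sum>i\<le>m. a' (s i) * B j (s i))"
        by (rule sum.reindex_bij_betw[OF bij, symmetric])
      also have "\<dots> = (\<Sum>i\<le>m. a i * B j (s i))" by (simp add: a'_def sl ts)
      finally show ?thesis .
    qed
    have "(\<Sum>i\<le>Suc m. a' i * B j i) = 0" if "j < Suc m" for j
    proof (cases "j = m")
      case True
      then show ?thesis using l unfolding sum by (simp add: a'_def)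
    next
      case False
      then have "(\<Sum>i\<le>m. a i * B' j i) = 0" using a that by simp
      then have "(\<Sum>i\<le>m. a i * B j (s i)) = (\<Sum>i\<le>m. a i * B m (s i)) * (B j l / B m l)"
        by (simp add: B'_def right_diff_distrib sum_subtractf sum_distrib_right sum_divide_distrib mult.assoc)
      then show ?thesis unfolding sum by (simp add: a'_def)
    qed
    moreover obtain i where "i \<le> m" "a i \<noteq> 0" using a by blast
    then have "s i \<le> Suc m \<and> a' (s i) \<noteq> 0" by (auto simp: a'_def sl ts) (simp add: s_def)
    ultimately show ?thesis by blast
  qed
qed

section \<open>From a worst case algorithm to a subspace\<close>

lemma semi_inner_F:
  assumes "inner_product_space_of_functions M F ip"
  shows "semi_inner F ip"
  using assms unfolding inner_product_space_of_functions_def by unfold_locales blast+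

text \<open>
  Otherwise there would be a sequence of unit vectors of \<open>F\<close> whose \<open>L\<^sub>2\<close>-norms tend to infinity, and no
  subsequence of it could converge in \<open>L\<^sub>2\<close>.
\<close>

lemma embedding_bounded:
  assumes H: "compactly_embedded_Hilbert_space M F ip"
  shows "\<exists>B\<ge>0. \<forall>f\<in>F. L2_norm M f \<le> B * f_norm ip f"
proof -
  have ips: "inner_product_space_of_functions M F ip" and ce: "compactly_embedded M F ip"
    using H by (auto simp: compactly_embedded_Hilbert_space_def)
  interpret F: semi_inner F ip by (rule semi_inner_F[OF ips])
  interpret L: semi_inner "L2 M" "L2_inner M" by (rule semi_inner_L2)
  have null_iff: "\<forall>f\<in>F. ip f f = 0 \<longleftrightarrow> (AE x in M. f x = 0)"
    using ips by (simp add: inner_product_space_of_functions_def)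
  have FL: "F \<subseteq> L2 M" using ce by (auto simp: compactly_embedded_def)
  show ?thesis
  proof (rule ccontr)
    assume "\<not> ?thesis"
    then have "\<exists>f\<in>F. L2_norm M f > real n * f_norm ip f" for n :: nat
      by (meson not_le of_nat_0_le_iff)
    then obtain u where u: "\<And>n. u n \<in> F" "\<And>n::nat. L2_norm M (u n) > real n * f_norm ip (u n)" by metis
    have pos: "0 < f_norm ip (u n)" for n
    proof -
      have "f_norm ip (u n) \<noteq> 0"
      proof
        assume "f_norm ip (u n) = 0"
        then have "ip (u n) (u n) = 0" using F.nonneg[OF u(1)[of n]] by (simp add: f_norm_def)
        then have "AE x in M. u n x = 0"
          using null_iff u(1) by blast
        then have "L2_inner M (u n) (u n) = 0"
          unfolding L2_inner_def by (intro integral_eq_zero_AE) auto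
        then show False using u(2)[of n] \<open>f_norm ip (u n) = 0\<close> by (simp add: L2_norm_eq)
      qed
      moreover have "0 \<le> f_norm ip (u n)" using F.nonneg[OF u(1)] by (simp add: f_norm_def)
      ultimately show ?thesis by simp
    qed
    define s where "s n = (\<lambda>x. (1 / f_norm ip (u n)) * u n x)" for n
    have sF: "s n \<in> F" for n unfolding s_def by (intro F.scale_in u)
    have "f_norm ip (s n) = 1" for n
      using pos[of n] F.scale_scale[OF u(1)[of n], of "1 / f_norm ip (u n)"]
      by (simp add: f_norm_def s_def power2_eq_square real_sqrt_divide)
    then have bnd: "bounded (range (\<lambda>n. f_norm ip (s n)))" by simp
    obtain g r where g: "g \<in> L2 M" "strict_mono (r :: nat \<Rightarrow> nat)"
        and lim: "(\<lambda>n. L2_dist M (s (r n)) g) \<longlonglongrightarrow> 0"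
    proof -
      have "\<exists>g\<in>L2 M. \<exists>r :: nat \<Rightarrow> nat. strict_mono r \<and> (\<lambda>n. L2_dist M (s (r n)) g) \<longlonglongrightarrow> 0"
        using ce[unfolded compactly_embedded_def, THEN conjunct2, rule_format, of s] sF bnd by blast
      then show thesis using that by blast
    qed
    have big: "real n < L2_norm M (s n)" for n
    proof -
      have "L2_norm M (s n) = L2_norm M (u n) / f_norm ip (u n)"
        using pos[of n] L.scale_scale[OF subsetD[OF FL u(1)[of n]], of "1 / f_norm ip (u n)"]
        by (simp add: L2_norm_eq s_def real_sqrt_divide power_divide)
      then show ?thesis using u(2)[of n] pos[of n] by (simp add: pos_less_divide_eq)
    qed
    have close: "L2_norm M (s n) \<le> L2_norm M g + L2_dist M (s n) g" for n
      using L.norm_diff_le[of "s n" g] sF FL g unfolding L2_norm_eq L2_dist_def by fastforce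
    have "\<forall>\<^sub>F n in sequentially. L2_dist M (s (r n)) g < 1"
      using lim by (rule order_tendstoD) simp
    moreover have "\<forall>\<^sub>F n in sequentially. n \<ge> nat \<lceil>L2_norm M g + 1\<rceil>" by (rule eventually_ge_at_top)
    ultimately have "\<forall>\<^sub>F n in sequentially. False"
    proof eventually_elim
      case (elim n)
      have "L2_norm M g + 1 \<le> real n" using elim by linarith
      also have "\<dots> \<le> real (r n)" using seq_suble[OF g(2)] by simp
      also have "\<dots> < L2_norm M (s (r n))" by (rule big)
      also have "\<dots> < L2_norm M g + 1" using close[of "r n"] elim by linarith
      finally show False .
    qed
    then show False by simp
  qed
qed

definition orthonormal :: "'a measure \<Rightarrow> nat \<Rightarrow> (nat \<Rightarrow> 'a \<Rightarrow> real) \<Rightarrow> bool" where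
  "orthonormal M k v \<longleftrightarrow>
     (\<forall>i<k. v i \<in> L2 M) \<and> (\<forall>i<k. \<forall>j<k. L2_inner M (v i) (v j) = (if i = j then 1 else 0))"

definition residual :: "'a measure \<Rightarrow> nat \<Rightarrow> (nat \<Rightarrow> 'a \<Rightarrow> real) \<Rightarrow> ('a \<Rightarrow> real) \<Rightarrow> 'a \<Rightarrow> real" where
  "residual M k v f = (\<lambda>x. f x - (\<Sum>i<k. L2_inner M f (v i) * v i x))"

text \<open>
  If the orthonormal systems in a subspace have bounded length, a longest one exists. It spans the subspace up to null
  functions, since a residual of positive norm could be normalized and added to the system.
\<close>

lemma maximal_orthonormal_system:
  assumes H: "W \<subseteq> L2 M" "(\<lambda>x. 0) \<in> W"
    and Wcomb: "\<And>f g s t. f \<in> W \<Longrightarrow> g \<in> W \<Longrightarrow> (\<lambda>x. s * f x + t * g x) \<in> W"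
    and bound: "\<And>k v. orthonormal M k v \<Longrightarrow> \<forall>i<k. v i \<in> W \<Longrightarrow> k \<le> m"
  shows "\<exists>k v. k \<le> m \<and> orthonormal M k v \<and>
    (\<forall>f\<in>W. L2_inner M (residual M k v f) (residual M k v f) = 0)"
proof -
  interpret L: semi_inner "L2 M" "L2_inner M" by (rule semi_inner_L2)
  define P where "P k \<longleftrightarrow> (\<exists>v. orthonormal M k v \<and> (\<forall>i<k. v i \<in> W))" for k
  have P0: "P 0" by (auto simp: P_def orthonormal_def)
  have Pm: "\<forall>k. P k \<longrightarrow> k \<le> m" using bound by (auto simp: P_def)
  define k where "k = (GREATEST k. P k)"
  have Pk: "P k" unfolding k_def using GreatestI_nat[of P, OF P0] Pm by blast
  have max: "k' \<le> k" if "P k'" for k' unfolding k_def using Greatest_le_nat[of P, OF that] Pm by blast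
  obtain v where v: "orthonormal M k v" "\<forall>i<k. v i \<in> W" using Pk by (auto simp: P_def)
  have "L2_inner M (residual M k v f) (residual M k v f) = 0" if f: "f \<in> W" for f
  proof (rule ccontr)
    let ?r = "residual M k v f"
    assume nz: "L2_inner M ?r ?r \<noteq> 0"
    have sumW: "(\<lambda>x. \<Sum>i<n. c i * v i x) \<in> W" if "n \<le> k" for n c
      using that
    proof (induction n)
      case (Suc n)
      then show ?case using v(2) Wcomb[of "\<lambda>x. \<Sum>i<n. c i * v i x" "v n" 1 "c n"] by simp
    qed (use H in simp)
    have rW: "?r \<in> W" using Wcomb[OF f sumW[of k], of 1 "-1"] by (simp add: residual_def)
    then have rL: "?r \<in> L2 M" using H by auto
    have orth: "L2_inner M ?r (v j) = 0" if "j < k" for j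
      using v f H that unfolding residual_def orthonormal_def
      by (subst L.orthonormal_residual) auto
    have pos: "0 < L2_inner M ?r ?r" using nz L.nonneg[OF rL] by simp
    let ?s = "1 / L2_norm M ?r"
    let ?w = "\<lambda>x. ?s * ?r x"
    have ww: "L2_inner M ?w ?w = 1"
      using pos by (simp only: L.scale_scale[OF rL]) (simp add: L2_norm_eq power_divide)
    have wv: "L2_inner M ?w (v j) = 0" "L2_inner M (v j) ?w = 0" if "j < k" for j
    proof -
      have vj: "v j \<in> L2 M" using v that by (auto simp: orthonormal_def)
      show "L2_inner M ?w (v j) = 0" using L.scale[OF rL vj, of ?s] orth[OF that] by simp
      then show "L2_inner M (v j) ?w = 0" using L.sym[OF vj L.scale_in[OF rL, of ?s]] by simp
    qed
    have "orthonormal M (Suc k) (v(k := ?w))"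
      using v ww wv L.scale_in[OF rL, of ?s] unfolding orthonormal_def
      by (auto simp: less_Suc_eq)
    moreover have "\<forall>i<Suc k. (v(k := ?w)) i \<in> W"
      using v Wcomb[OF rW rW, of ?s 0] by (auto simp: less_Suc_eq)
    ultimately have "P (Suc k)" unfolding P_def by blast
    from max[OF this] show False by simp
  qed
  then show ?thesis using v Pm Pk by blast
qed

lemma (in semi_inner) f_norm_lim:
  assumes "\<And>n. g n \<in> S" "p \<in> S" "(\<lambda>n. f_dist b (g n) p) \<longlonglongrightarrow> 0"
  shows "(\<lambda>n. f_norm b (g n)) \<longlonglongrightarrow> f_norm b p"
proof -
  have "(\<lambda>n. f_norm b (g n) - f_norm b p) \<longlonglongrightarrow> 0"
  proof (rule Lim_null_comparison[OF _ assms(3)])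
    show "\<forall>\<^sub>F n in sequentially. norm (f_norm b (g n) - f_norm b p) \<le> f_dist b (g n) p"
      using norm_diff_le[OF assms(1,2)] by (simp add: f_norm_def f_dist_def)
  qed
  then show ?thesis by (simp add: LIM_zero_iff)
qed

text \<open>
  Here \<open>W\<close> is the \<open>F\<close>-orthogonal complement of the kernel \<open>N\<close> of the information. An orthonormal
  system in \<open>W\<close> has at most \<open>m\<close> elements: of \<open>m + 1\<close> elements a nontrivial combination would lie in \<open>N\<close>,
  hence be orthogonal to itself. For \<open>f = h + p\<close> with \<open>h\<close> in \<open>W\<close> and \<open>p\<close> in the closure of \<open>N\<close>, the
  \<open>L\<^sub>2\<close>-projection onto the span of a maximal system reproduces \<open>h\<close>, so that up to a null function the residual of \<open>f\<close>
  is the residual of \<open>p\<close>. The latter is no larger than \<open>p\<close> itself, whose \<open>L\<^sub>2\<close>-norm is at most \<open>e\<close> because \<open>p\<close> is a limit of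
  elements of \<open>N\<close> and its \<open>F\<close>-norm is at most that of \<open>f\<close>.
\<close>

lemma subspace_from_worst_case_algorithm:
  fixes e :: real
  assumes H: "compactly_embedded_Hilbert_space M F ip"
    and L: "\<And>j. j < m \<Longrightarrow> L j \<in> info_all F"
    and \<phi>: "\<phi> \<in> measurable (real_pow m) (L2_borel M)"
    and err: "\<And>f. f \<in> unit_ball F ip \<Longrightarrow> L2_dist M f (\<phi> (info_vec L m f)) \<le> e"
  shows "\<exists>k v. k \<le> m \<and> orthonormal M k v \<and>
    (\<forall>f\<in>unit_ball F ip. L2_norm M (residual M k v f) \<le> e)"
proof -
  have ips: "inner_product_space_of_functions M F ip" and ce: "compactly_embedded M F ip"
    and compl: "complete_space_of_functions F ip"
    using H by (auto simp: compactly_embedded_Hilbert_space_def)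
  interpret F: semi_inner F ip by (rule semi_inner_F[OF ips])
  interpret L: semi_inner "L2 M" "L2_inner M" by (rule semi_inner_L2)
  have null_iff: "\<forall>f\<in>F. ip f f = 0 \<longleftrightarrow> (AE x in M. f x = 0)"
    using ips by (simp add: inner_product_space_of_functions_def)
  have FL: "F \<subseteq> L2 M" using ce by (auto simp: compactly_embedded_def)
  have null: "L2_inner M f f = 0" if "f \<in> F" "ip f f = 0" for f
  proof -
    have "AE x in M. f x = 0" using null_iff that by blast
    then show ?thesis unfolding L2_inner_def by (intro integral_eq_zero_AE) auto
  qed
  obtain B where B: "0 \<le> B" "\<And>f. f \<in> F \<Longrightarrow> L2_norm M f \<le> B * f_norm ip f"
    using embedding_bounded[OF H] by blast
  have Lcomb: "L j (\<lambda>x. s * f x + t * g x) = s * L j f + t * L j g"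
    if "j < m" "f \<in> F" "g \<in> F" for j s t f g
    using L[OF that(1)] that unfolding info_all_def by blast
  have L0: "L j (\<lambda>x. 0) = 0" if "j < m" for j
    using Lcomb[OF that F.zero_in F.zero_in, of 0 0] by simp
  define N where "N = {f \<in> F. \<forall>j<m. L j f = 0}"
  have N: "N \<subseteq> F" "(\<lambda>x. 0) \<in> N" by (auto simp: N_def F.zero_in L0)
  have Ncomb: "(\<lambda>x. s * f x + t * g x) \<in> N" if "f \<in> N" "g \<in> N" for f g s t
    using that by (auto simp: N_def F.comb_in Lcomb)
  \<comment> \<open>\<open>f\<close> and \<open>- f\<close> have the same information, so one of them is badly approximated\<close>
  have ball: "L2_norm M f \<le> e" if f: "f \<in> N" "f_norm ip f \<le> 1" for f
  proof -
    have fF: "f \<in> F" using f N by auto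
    let ?nf = "\<lambda>x. (-1) * f x"
    have nf: "?nf \<in> N" using Ncomb[OF f(1) f(1), of "-1" 0] by simp
    have nfF: "?nf \<in> F" using nf N by auto
    have info: "info_vec L m f = info_vec L m (\<lambda>x. 0)" "info_vec L m ?nf = info_vec L m (\<lambda>x. 0)"
      using f(1) nf by (auto simp: info_vec_def N_def L0)
    define g where "g = \<phi> (info_vec L m (\<lambda>x. 0))"
    have "info_vec L m (\<lambda>x. 0) \<in> space (real_pow m)" by (auto simp: info_vec_def space_PiM)
    then have g: "g \<in> L2 M"
      using measurable_space[OF \<phi>] by (simp add: g_def L2_borel_def space_measure_of_conv)
    have fL: "f \<in> L2 M" using fF FL by auto
    have "f_norm ip ?nf = f_norm ip f" unfolding f_norm_def F.scale_scale[OF fF] by simp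
    then have "L2_dist M f g \<le> e" "L2_dist M ?nf g \<le> e"
      using err[of f] err[of ?nf] f fF nfF unfolding unit_ball_def g_def info by simp_all
    moreover have "0 \<le> L2_dist M f g"  "0 \<le> L2_dist M ?nf g" by (auto simp: L2_dist_def L2_norm_def)
    ultimately have e: "0 \<le> e" "(L2_dist M f g)\<^sup>2 \<le> e\<^sup>2" "(L2_dist M ?nf g)\<^sup>2 \<le> e\<^sup>2"
      by (auto intro: power_mono)
    have "(L2_dist M f g)\<^sup>2 = L2_inner M f f - 2 * L2_inner M f g + L2_inner M g g"
      unfolding L2_dist_def L2_norm_power2 by (rule L.diff_diff[OF fL g])
    moreover have "(L2_dist M ?nf g)\<^sup>2 = L2_inner M f f + 2 * L2_inner M f g + L2_inner M g g"
      unfolding L2_dist_def L2_norm_power2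
      using L.diff_diff[OF L.scale_in[OF fL, of "-1"] g] L.scale[OF fL g, of "-1"] L.scale_scale[OF fL, of "-1"]
      by simp
    ultimately have "L2_inner M f f \<le> e\<^sup>2" using e L.nonneg[OF g] by linarith
    then show ?thesis using e by (simp add: L2_norm_eq real_le_lsqrt)
  qed
  have e0: "0 \<le> e" using ball[OF N(2)] by (simp add: f_norm_def F.zero_left F.zero_in L2_norm_def)
  have Nle: "L2_norm M f \<le> e * f_norm ip f" if f: "f \<in> N" for f
  proof (cases "f_norm ip f = 0")
    case True
    then show ?thesis using f N B(2)[of f] by auto
  next
    case False
    have fF: "f \<in> F" using f N by auto
    then have pos: "0 < f_norm ip f" using False F.nonneg[OF fF] by (simp add: f_norm_def)
    let ?g = "\<lambda>x. (1 / f_norm ip f) * f x"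
    have "?g \<in> N" using Ncomb[OF f f, of "1 / f_norm ip f" 0] by simp
    moreover have "f_norm ip ?g = 1"
      using pos by (simp add: f_norm_def F.scale_scale[OF fF, of "1 / _", simplified] real_sqrt_divide power_divide)
    ultimately have "L2_norm M ?g \<le> e" using ball by simp
    moreover have "L2_norm M ?g = L2_norm M f / f_norm ip f"
      using pos L.scale_scale[OF subsetD[OF FL fF], of "1 / f_norm ip f"]
      by (simp add: L2_norm_eq real_sqrt_divide power_divide)
    ultimately have "L2_norm M f / f_norm ip f \<le> e" by simp
    then show ?thesis using pos by (simp add: pos_divide_le_eq)
  qed
  define W where "W = {h \<in> F. \<forall>g\<in>N. ip h g = 0}"
  have WF: "W \<subseteq> F" by (auto simp: W_def)
  have W0: "(\<lambda>x. 0) \<in> W" using N by (auto simp: W_def F.zero_in intro!: F.zero_left)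
  have Wcomb: "(\<lambda>x. s * f x + t * g x) \<in> W" if "f \<in> W" "g \<in> W" for f g s t
    using that N by (auto simp: W_def F.comb_in F.comb subset_iff)
  have bound: "k \<le> m" if on: "orthonormal M k v" and vW: "\<forall>i<k. v i \<in> W" for k v
  proof (rule ccontr)
    assume "\<not> k \<le> m"
    then have mk: "i < k" if "i \<le> m" for i using that by auto
    obtain a where a: "\<exists>i\<le>m. a i \<noteq> 0" "\<forall>j<m. (\<Sum>i\<le>m. a i * L j (v i)) = 0"
      using homogeneous_system_nontrivial_solution[of m "\<lambda>j i. L j (v i)"] by blast
    have vF: "v i \<in> F" if "i \<le> m" for i using vW WF mk[OF that] by auto
    define h where "h n = (\<lambda>x. \<Sum>i<n. a i * v i x)" for n
    have hF: "h n \<in> F" if "n \<le> Suc m" for n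
      unfolding h_def using that vF by (intro F.sum_in) auto
    have hL: "L j (h n) = (\<Sum>i<n. a i * L j (v i))" if "j < m" "n \<le> Suc m" for j n
      using that(2)
    proof (induction n)
      case 0
      show ?case using L0[OF that(1)] by (simp add: h_def)
    next
      case (Suc n)
      have "L j (\<lambda>x. 1 * h n x + a n * v n x) = 1 * L j (h n) + a n * L j (v n)"
        using Suc vF hF by (intro Lcomb that) auto
      then show ?case using Suc by (simp add: h_def)
    qed
    let ?h = "h (Suc m)"
    have "?h \<in> N" using hF hL a by (auto simp: N_def lessThan_Suc_atMost)
    then have "ip (v i) ?h = 0" if "i \<le> m" for i using vW mk[OF that] by (auto simp: W_def)
    then have "ip ?h ?h = 0"
      using hF[of "Suc m"] vF by (subst (1) h_def, subst F.sum_left) auto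
    then have 0: "L2_inner M ?h ?h = 0" using null hF[of "Suc m"] by blast
    have hLL: "?h \<in> L2 M" using hF[of "Suc m"] FL by auto
    have vL: "v i \<in> L2 M" if "i \<le> m" for i using vF[OF that] FL by auto
    have "a i = 0" if i: "i \<le> m" for i
    proof -
      have "L2_inner M ?h (v i) = (\<Sum>l<Suc m. a l * L2_inner M (v l) (v i))"
        unfolding h_def using vL i by (intro L.sum_left) auto
      also have "\<dots> = (\<Sum>l<Suc m. a l * (if l = i then 1 else 0))"
        using on mk i by (intro sum.cong) (auto simp: orthonormal_def)
      also have "\<dots> = a i" using i by (simp add: if_distrib[of "\<lambda>x. _ * x"] cong: if_cong del: sum.lessThan_Suc)
      finally show ?thesis using L.Cauchy_Schwarz[OF hLL vL[OF i]] 0 by simp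
    qed
    then show False using a by blast
  qed
  obtain k v where kvr: "k \<le> m \<and> orthonormal M k v \<and>
      (\<forall>f\<in>W. L2_inner M (residual M k v f) (residual M k v f) = 0)"
  proof -
    have "\<exists>k v. k \<le> m \<and> orthonormal M k v \<and>
        (\<forall>f\<in>W. L2_inner M (residual M k v f) (residual M k v f) = 0)"
    proof (rule maximal_orthonormal_system[OF subset_trans[OF WF FL] W0])
      show "(\<lambda>x. s * f x + t * g x) \<in> W" if "f \<in> W" "g \<in> W" for f g s t
        using that by (rule Wcomb)
      show "k \<le> m" if "orthonormal M k v" "\<forall>i<k. v i \<in> W" for k v
        using that by (rule bound)
    qed
    then show thesis using that by (elim exE)
  qed
  have kv: "k \<le> m" "orthonormal M k v" using kvr by auto
  have res: "L2_inner M (residual M k v f) (residual M k v f) = 0" if "f \<in> W" for f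
    using kvr that by auto
  have vL: "v i \<in> L2 M" if "i < k" for i using kv that by (auto simp: orthonormal_def)
  have on: "L2_inner M (v i) (v j) = (if i = j then 1 else 0)" if "i < k" "j < k" for i j
    using kv that by (auto simp: orthonormal_def)
  have "L2_norm M (residual M k v f) \<le> e" if f: "f \<in> unit_ball F ip" for f
  proof -
    have fF: "f \<in> F" and f1: "f_norm ip f \<le> 1" using f by (auto simp: unit_ball_def)
    obtain p g where pg: "p \<in> F \<and> (\<forall>n::nat. g n \<in> N) \<and> (\<lambda>n. f_dist ip (g n) p) \<longlonglongrightarrow> 0 \<and>
        (\<forall>h\<in>N. ip (\<lambda>x. f x - p x) h = 0)"
    proof -
      have "\<exists>p g. p \<in> F \<and> (\<forall>n::nat. g n \<in> N) \<and> (\<lambda>n. f_dist ip (g n) p) \<longlonglongrightarrow> 0 \<and>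
          (\<forall>h\<in>N. ip (\<lambda>x. f x - p x) h = 0)"
      proof (rule F.projection_exists[OF N(2,1) _ compl fF])
        show "(\<lambda>x. s * f x + t * g x) \<in> N" if "f \<in> N" "g \<in> N" for f g s t
          using that by (rule Ncomb)
      qed
      then show thesis using that by (elim exE)
    qed
    have p: "p \<in> F" and g: "g n \<in> N" and lim: "(\<lambda>n. f_dist ip (g n) p) \<longlonglongrightarrow> 0"
      and orth: "h \<in> N \<Longrightarrow> ip (\<lambda>x. f x - p x) h = 0" for h n
      using pg by auto
    have gF: "g n \<in> F" for n using g N by auto
    let ?h = "\<lambda>x. f x - p x"
    have hF: "?h \<in> F" using fF p by (rule F.diff_in)
    then have hW: "?h \<in> W" using orth by (simp add: W_def)
    have "ip ?h p = 0"
    proof -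
      have "(\<lambda>n. ip ?h (\<lambda>x. g n x - p x)) \<longlonglongrightarrow> 0"
      proof (rule Lim_null_comparison)
        show "\<forall>\<^sub>F n in sequentially. norm (ip ?h (\<lambda>x. g n x - p x)) \<le> f_norm ip ?h * f_dist ip (g n) p"
          using F.abs_le[OF hF F.diff_in[OF gF p]] by (simp add: f_norm_def f_dist_def)
        show "(\<lambda>n. f_norm ip ?h * f_dist ip (g n) p) \<longlonglongrightarrow> 0" using lim by (intro tendsto_mult_right_zero)
      qed
      moreover have "ip ?h (\<lambda>x. g n x - p x) = - ip ?h p" for n
        using F.diff[OF gF p hF, of n] orth[OF g[of n]] F.sym[OF hF gF[of n]] F.sym[OF hF p]
          F.sym[OF hF F.diff_in[OF gF[of n] p]] by simp
      ultimately show ?thesis by (simp add: tendsto_const_iff)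
    qed
    then have "ip f f = ip ?h ?h + ip p p"
      using F.diff_diff[OF fF p] F.diff[OF fF p p] by simp
    then have "f_norm ip p \<le> f_norm ip f" using F.nonneg[OF hF] by (simp add: f_norm_def)
    then have p1: "f_norm ip p \<le> 1" using f1 by simp
    have pe: "L2_norm M p \<le> e * f_norm ip p"
    proof (rule LIMSEQ_le)
      show "(\<lambda>n. e * f_norm ip (g n)) \<longlonglongrightarrow> e * f_norm ip p"
        using F.f_norm_lim[OF gF p lim] by (intro tendsto_intros)
      have "(\<lambda>n. B * f_dist ip (g n) p) \<longlonglongrightarrow> 0" using lim by (intro tendsto_mult_right_zero)
      then have "(\<lambda>n. f_dist (L2_inner M) (g n) p) \<longlonglongrightarrow> 0"
      proof (rule Lim_null_comparison[rotated])
        show "\<forall>\<^sub>F n in sequentially. norm (f_dist (L2_inner M) (g n) p) \<le> B * f_dist ip (g n) p"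
          using B(2)[OF F.diff_in[OF gF p]] L.nonneg[OF L.diff_in] gF p FL
          by (auto simp: f_dist_def f_norm_def L2_norm_eq subset_iff intro!: always_eventually)
      qed
      then have "(\<lambda>n. f_norm (L2_inner M) (g n)) \<longlonglongrightarrow> f_norm (L2_inner M) p"
        using gF p FL by (intro L.f_norm_lim) auto
      then show "(\<lambda>n. L2_norm M (g n)) \<longlonglongrightarrow> L2_norm M p" by (simp add: f_norm_def L2_norm_eq)
    qed (use Nle g in auto)
    also have "\<dots> \<le> e" using p1 e0 by (simp add: mult_left_le)
    finally have pe: "L2_norm M p \<le> e" .
    have fL: "f \<in> L2 M" and pL: "p \<in> L2 M" and hL: "?h \<in> L2 M" using fF p hF FL by auto
    \<comment> \<open>up to a null function, the residuals of \<open>f\<close> and \<open>p\<close> agree\<close>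
    let ?Rf = "residual M k v f" and ?Rp = "residual M k v p" and ?Rh = "residual M k v ?h"
    have sumL: "(\<lambda>x. \<Sum>i<k. c i * v i x) \<in> L2 M" for c using vL by (intro L.sum_in) auto
    have RL: "?Rf \<in> L2 M" "?Rp \<in> L2 M" unfolding residual_def
      using L.diff_in[OF fL sumL] L.diff_in[OF pL sumL] by auto
    have "(\<lambda>x. ?Rf x - ?Rp x) = ?Rh"
    proof
      fix x
      have "(\<Sum>i<k. L2_inner M ?h (v i) * v i x) =
          (\<Sum>i<k. L2_inner M f (v i) * v i x) - (\<Sum>i<k. L2_inner M p (v i) * v i x)"
        unfolding sum_subtractf[symmetric]
        using vL fL pL by (intro sum.cong refl) (auto simp: L.diff left_diff_distrib)
      then show "?Rf x - ?Rp x = ?Rh x" by (simp add: residual_def)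
    qed
    then have "\<bar>L2_norm M ?Rf - L2_norm M ?Rp\<bar> \<le> sqrt (L2_inner M ?Rh ?Rh)"
      using L.norm_diff_le[OF RL] by (simp add: L2_norm_eq)
    then have "L2_norm M ?Rf \<le> L2_norm M ?Rp" using res[OF hW] by simp
    also have "\<dots> \<le> L2_norm M p"
      using L.projection_norm_le[of k v p, OF vL on pL] by (simp add: L2_norm_eq residual_def)
    also note pe
    finally show ?thesis .
  qed
  then show ?thesis using kv by blast
qed

section \<open>Volume sampling\<close>

text \<open>
  The determinant of the matrix \<open>G i j\<close> with \<open>i, j < k\<close>. Rows are functions, so that a row is replaced by
  a function update, and the size is an ordinary number.
\<close>

definition Leibniz_det :: "nat \<Rightarrow> (nat \<Rightarrow> nat \<Rightarrow> real) \<Rightarrow> real" where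
  "Leibniz_det k G = (\<Sum>p | p permutes {..<k}. of_int (sign p) * (\<Prod>j<k. G (p j) j))"

lemma Leibniz_det_cong:
  assumes "\<And>i j. i < k \<Longrightarrow> j < k \<Longrightarrow> G i j = H i j"
  shows "Leibniz_det k G = Leibniz_det k H"
  unfolding Leibniz_det_def using assms
  by (intro sum.cong prod.cong refl arg_cong2[of _ _ _ _ "(*)"]) (auto dest: permutes_in_image[THEN iffD2])

lemma Leibniz_det_expand_row:
  assumes i: "i < k"
  shows "Leibniz_det k (G(i := u)) =
    (\<Sum>j<k. u j * Leibniz_det k (G(i := (\<lambda>l. if l = j then 1 else 0))))"
proof -
  have *: "of_int (sign p) * (\<Prod>j<k. (G(i := u)) (p j) j) =
      (\<Sum>j<k. u j * (of_int (sign p) * (\<Prod>l<k. (G(i := (\<lambda>l. if l = j then 1 else 0))) (p l) l)))"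
    if p: "p permutes {..<k}" for p
  proof -
    define j0 where "j0 = inv p i"
    have pj0: "p j0 = i" using permutes_inverses[OF p] by (simp add: j0_def)
    have j0: "j0 < k" using permutes_in_image[OF p, of j0] pj0 i by simp
    have ne: "p j \<noteq> i" if "j \<noteq> j0" for j
      using pj0 that permutes_inj[OF p] by (metis injD)
    have split: "(\<Prod>j<k. (G(i := w)) (p j) j) = w j0 * (\<Prod>j\<in>{..<k}-{j0}. G (p j) j)" for w
    proof -
      have "(\<Prod>j<k. (G(i := w)) (p j) j) = (G(i := w)) (p j0) j0 * (\<Prod>j\<in>{..<k}-{j0}. (G(i := w)) (p j) j)"
        using j0 by (intro prod.remove) auto
      also have "(\<Prod>j\<in>{..<k}-{j0}. (G(i := w)) (p j) j) = (\<Prod>j\<in>{..<k}-{j0}. G (p j) j)"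
        by (intro prod.cong) (auto simp: ne)
      finally show ?thesis by (simp add: pj0)
    qed
    show ?thesis unfolding split using j0
      by (simp add: if_distrib[of "\<lambda>x. _ * x"] if_distrib[of "\<lambda>x. x * _"] cong: if_cong)
  qed
  have "Leibniz_det k (G(i := u)) = (\<Sum>p | p permutes {..<k}.
      \<Sum>j<k. u j * (of_int (sign p) * (\<Prod>l<k. (G(i := (\<lambda>l. if l = j then 1 else 0))) (p l) l)))"
    unfolding Leibniz_det_def by (intro sum.cong refl) (use * in auto)
  also have "\<dots> = (\<Sum>j<k. u j * Leibniz_det k (G(i := (\<lambda>l. if l = j then 1 else 0))))"
    unfolding Leibniz_det_def by (subst sum.swap) (simp only: sum_distrib_left)
  finally show ?thesis .
qed

lemma Leibniz_det_equal_rows: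
  assumes i: "i < k" and l: "l < k" and il: "i \<noteq> l" and eq: "\<And>j. j < k \<Longrightarrow> G i j = G l j"
  shows "Leibniz_det k G = 0"
proof -
  let ?t = "Transposition.transpose i l"
  have t: "?t permutes {..<k}" using i l by (intro permutes_swap_id) auto
  have Gt: "G (?t a) j = G a j" if "j < k" for a j
    using eq[OF that] by (auto simp: Transposition.transpose_def)
  have "Leibniz_det k G = (\<Sum>p | p permutes {..<k}. of_int (sign (?t \<circ> p)) * (\<Prod>j<k. G ((?t \<circ> p) j) j))"
    unfolding Leibniz_det_def by (rule setum_permutations_compose_left[OF t])
  also have "\<dots> = (\<Sum>p | p permutes {..<k}. - (of_int (sign p) * (\<Prod>j<k. G (p j) j)))"
  proof (intro sum.cong refl)
    fix p assume "p \<in> {p. p permutes {..<k}}"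
    then have "sign (?t \<circ> p) = - sign p"
      using il t permutes_imp_permutation[of "{..<k}"] by (auto simp: sign_compose sign_swap_id)
    then show "of_int (sign (?t \<circ> p)) * (\<Prod>j<k. G ((?t \<circ> p) j) j) = - (of_int (sign p) * (\<Prod>j<k. G (p j) j))"
      by (simp add: Gt)
  qed
  also have "\<dots> = - Leibniz_det k G" by (simp add: Leibniz_det_def sum_negf)
  finally show ?thesis by simp
qed

text \<open>
  Cramer's rule with a perturbation \<open>r\<close> of the right-hand side: divided by \<open>Leibniz_det k G\<close>, the left-hand
  side is the coefficient computed by interpolation and \<open>a i\<close> is the true one, so that the error only
  depends on \<open>r\<close>.
\<close>

lemma Leibniz_det_Cramer:
  assumes i: "i < k"
  shows "Leibniz_det k (G(i := (\<lambda>j. r j + (\<Sum>l<k. a l * G l j)))) =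
    Leibniz_det k (G(i := r)) + a i * Leibniz_det k G"
proof -
  let ?e = "\<lambda>j. Leibniz_det k (G(i := (\<lambda>l. if l = j then 1 else 0)))"
  have row: "(\<Sum>j<k. G l j * ?e j) = (if l = i then Leibniz_det k G else 0)" if l: "l < k" for l
  proof -
    have "(\<Sum>j<k. G l j * ?e j) = Leibniz_det k (G(i := G l))"
      by (rule Leibniz_det_expand_row[OF i, symmetric])
    also have "\<dots> = (if l = i then Leibniz_det k G else 0)"
      using i l by (auto intro!: Leibniz_det_equal_rows[of i k l])
    finally show ?thesis .
  qed
  have "Leibniz_det k (G(i := (\<lambda>j. r j + (\<Sum>l<k. a l * G l j)))) =
      (\<Sum>j<k. r j * ?e j) + (\<Sum>j<k. \<Sum>l<k. a l * (G l j * ?e j))"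
    by (subst Leibniz_det_expand_row[OF i]) (simp add: ring_distribs sum.distrib sum_distrib_right mult.assoc)
  also have "(\<Sum>j<k. \<Sum>l<k. a l * (G l j * ?e j)) = (\<Sum>l<k. a l * (\<Sum>j<k. G l j * ?e j))"
    by (subst sum.swap) (simp add: sum_distrib_left)
  also have "\<dots> = (\<Sum>l<k. a l * (if l = i then Leibniz_det k G else 0))"
    by (intro sum.cong refl) (simp add: row)
  also have "\<dots> = a i * Leibniz_det k G"
    using i by (simp add: if_distrib[of "\<lambda>x. _ * x"] cong: if_cong)
  also have "(\<Sum>j<k. r j * ?e j) = Leibniz_det k (G(i := r))"
    by (rule Leibniz_det_expand_row[OF i, symmetric])
  finally show ?thesis .
qed

lemma Leibniz_det_measurable:
  assumes "\<And>i j. i < k \<Longrightarrow> j < k \<Longrightarrow> (\<lambda>x. G x i j) \<in> borel_measurable N"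
  shows "(\<lambda>x. Leibniz_det k (G x)) \<in> borel_measurable N"
  unfolding Leibniz_det_def
proof (intro borel_measurable_sum borel_measurable_times borel_measurable_prod measurable_const)
  fix p j assume "p \<in> {p. p permutes {..<k}}" "j \<in> {..<k}"
  then show "(\<lambda>x. G x (p j) j) \<in> borel_measurable N"
    using permutes_in_image[of p "{..<k}" j] by (intro assms) auto
qed auto

text \<open>
  The square of the determinant is a sum over pairs of permutations of products over the points.
  Integrating point by point, orthogonality leaves the diagonal pairs only, which all contribute the same.
\<close>

lemma integral_Leibniz_det_square:
  fixes g :: "nat \<Rightarrow> 'a \<Rightarrow> real"
  assumes M: "prob_space M" and g: "\<And>i. i < k \<Longrightarrow> g i \<in> L2 M"
    and orth: "\<And>i j. i < k \<Longrightarrow> j < k \<Longrightarrow> i \<noteq> j \<Longrightarrow> L2_inner M (g i) (g j) = 0"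
  shows "integrable (Pi\<^sub>M {..<k} (\<lambda>_. M)) (\<lambda>x. (Leibniz_det k (\<lambda>i j. g i (x j)))\<^sup>2)" (is ?int)
    and "(LINT x|Pi\<^sub>M {..<k} (\<lambda>_. M). (Leibniz_det k (\<lambda>i j. g i (x j)))\<^sup>2) =
      fact k * (\<Prod>i<k. L2_inner M (g i) (g i))" (is ?val)
proof -
  interpret prob_space M by (rule M)
  interpret product_sigma_finite "\<lambda>_::nat. M" ..
  let ?S = "{p. p permutes {..<k}}"
  let ?t = "\<lambda>p q x. (of_int (sign p) * of_int (sign q)) * (\<Prod>j<k. g (p j) (x j) * g (q j) (x j))"
  have fin: "finite ?S" by (intro finite_permutations) simp
  have pk: "p j < k" if "p \<in> ?S" "j < k" for p j
    using that permutes_in_image[of p "{..<k}" j] by auto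
  have sq: "(Leibniz_det k (\<lambda>i j. g i (x j)))\<^sup>2 = (\<Sum>p\<in>?S. \<Sum>q\<in>?S. ?t p q x)" for x
    unfolding Leibniz_det_def power2_eq_square sum_product
    by (intro sum.cong refl) (simp add: prod.distrib)
  have int1: "integrable M (\<lambda>y. g (p j) y * g (q j) y)" if "p \<in> ?S" "q \<in> ?S" "j < k" for p q j
    using that pk by (intro L2_mult_integrable g) auto
  have int: "integrable (Pi\<^sub>M {..<k} (\<lambda>_. M)) (?t p q)" if "p \<in> ?S" "q \<in> ?S" for p q
    using that int1 by (intro integrable_mult_right product_integrable_prod) auto
  show ?int unfolding sq using int by (intro Bochner_Integration.integrable_sum) auto
  have val: "(LINT x|Pi\<^sub>M {..<k} (\<lambda>_. M). ?t p q x) =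
      (if p = q then \<Prod>i<k. L2_inner M (g i) (g i) else 0)" if p: "p \<in> ?S" and q: "q \<in> ?S" for p q
  proof -
    have "(LINT x|Pi\<^sub>M {..<k} (\<lambda>_. M). ?t p q x) =
        of_int (sign p) * of_int (sign q) * (\<Prod>j<k. L2_inner M (g (p j)) (g (q j)))"
      unfolding L2_inner_def using int1[OF p q]
      by (subst integral_mult_right_zero, subst product_integral_prod) auto
    also have "\<dots> = (if p = q then \<Prod>i<k. L2_inner M (g i) (g i) else 0)"
    proof (cases "p = q")
      case True
      have "(\<Prod>j<k. L2_inner M (g (p j)) (g (p j))) = (\<Prod>i<k. L2_inner M (g i) (g i))"
        using p by (intro prod.reindex_bij_betw permutes_imp_bij) auto
      moreover have "of_int (sign p) * of_int (sign p) = (1::real)"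
        by (simp flip: of_int_mult)
      ultimately show ?thesis using True by simp
    next
      case False
      then obtain j where j: "p j \<noteq> q j" by auto
      have "j < k"
      proof (rule ccontr)
        assume "\<not> j < k"
        then show False using p q j by (auto simp: permutes_def)
      qed
      then have "L2_inner M (g (p j)) (g (q j)) = 0" using orth pk p q j by blast
      then have "(\<Prod>j<k. L2_inner M (g (p j)) (g (q j))) = 0" using \<open>j < k\<close> by (intro prod_zero) auto
      then show ?thesis using False by simp
    qed
    finally show ?thesis .
  qed
  have "(LINT x|Pi\<^sub>M {..<k} (\<lambda>_. M). (Leibniz_det k (\<lambda>i j. g i (x j)))\<^sup>2) =
      (\<Sum>p\<in>?S. \<Sum>q\<in>?S. LINT x|Pi\<^sub>M {..<k} (\<lambda>_. M). ?t p q x)"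
  proof -
    have "(LINT x|Pi\<^sub>M {..<k} (\<lambda>_. M). (Leibniz_det k (\<lambda>i j. g i (x j)))\<^sup>2) =
        (\<Sum>p\<in>?S. LINT x|Pi\<^sub>M {..<k} (\<lambda>_. M). (\<Sum>q\<in>?S. ?t p q x))"
      unfolding sq
      by (rule Bochner_Integration.integral_sum, rule Bochner_Integration.integrable_sum, rule int)
    also have "\<dots> = (\<Sum>p\<in>?S. \<Sum>q\<in>?S. LINT x|Pi\<^sub>M {..<k} (\<lambda>_. M). ?t p q x)"
      by (rule sum.cong[OF refl], rule Bochner_Integration.integral_sum, rule int)
    finally show ?thesis .
  qed
  also have "\<dots> = (\<Sum>p\<in>?S. \<Sum>q\<in>?S. if p = q then \<Prod>i<k. L2_inner M (g i) (g i) else 0)"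
    by (intro sum.cong refl val)
  also have "\<dots> = (\<Sum>p\<in>?S. \<Prod>i<k. L2_inner M (g i) (g i))"
    using fin by (intro sum.cong refl) simp
  also have "\<dots> = fact k * (\<Prod>i<k. L2_inner M (g i) (g i))"
    using card_permutations[of "{..<k}" k] by simp
  finally show ?val .
qed

text \<open>
  A scheme draws \<open>n\<close> points with joint distribution \<open>P\<close> and estimates the coefficients of \<open>f\<close> with respect to
  \<open>v\<close> linearly from the values of \<open>f\<close> there, with weights \<open>h\<close> that depend on the points. The error is
  measured relative to the residual of \<open>f\<close>; in particular elements of the span are recovered exactly,
  with probability one.
\<close>

definition coefficient_scheme :: "'a measure \<Rightarrow> nat \<Rightarrow> (nat \<Rightarrow> 'a \<Rightarrow> real) \<Rightarrow> nat \<Rightarrow> real \<Rightarrow> bool" where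
  "coefficient_scheme M k v n \<beta> \<longleftrightarrow>
     (\<exists>P h. prob_space P \<and> sets P = sets (Pi\<^sub>M {..<n} (\<lambda>_. M)) \<and>
       (\<forall>i<k. \<forall>j<n. (\<lambda>x. h x i j) \<in> borel_measurable P) \<and>
       (\<forall>f\<in>L2 M. (\<integral>\<^sup>+x. ennreal (\<Sum>i<k. ((\<Sum>j<n. h x i j * f (x j)) - L2_inner M f (v i))\<^sup>2) \<partial>P)
          \<le> ennreal (\<beta> * (L2_norm M (residual M k v f))\<^sup>2)))"

lemma coordinate_measurable:
  assumes "f \<in> borel_measurable M" "j < n"
  shows "(\<lambda>x. f (x j)) \<in> borel_measurable (Pi\<^sub>M {..<n} (\<lambda>_. M))"
  using assms by (intro measurable_compose[OF measurable_component_singleton]) auto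

text \<open>
  With \<open>D\<close> the determinant of the matrix of values and \<open>R i\<close> the determinant in which row \<open>i\<close> is replaced
  by the values of the residual, the error of coefficient \<open>i\<close> is \<open>R i / D\<close>. As the density of the points is
  \<open>D\<^sup>2 / k!\<close>, its mean square is at most the integral of \<open>(R i)\<^sup>2 / k!\<close>, the squared norm of the residual;
  there are \<open>k\<close> coefficients.
\<close>

lemma volume_sampling:
  assumes M: "prob_space M" and on: "orthonormal M k v"
  shows "coefficient_scheme M k v k (real k)"
proof -
  interpret L: semi_inner "L2 M" "L2_inner M" by (rule semi_inner_L2)
  have v: "v i \<in> L2 M" if "i < k" for i using on that by (auto simp: orthonormal_def)
  have vv: "L2_inner M (v i) (v j) = (if i = j then 1 else 0)" if "i < k" "j < k" for i j
    using on that by (auto simp: orthonormal_def)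
  define PM where "PM = Pi\<^sub>M {..<k} (\<lambda>_. M)"
  define V where "V x = (\<lambda>i j. v i (x j))" for x :: "nat \<Rightarrow> 'a"
  define D where "D x = Leibniz_det k (V x)" for x
  have [measurable]: "(\<lambda>x. f (x j)) \<in> borel_measurable PM" if "f \<in> L2 M" "j < k" for f j
    unfolding PM_def using that by (intro coordinate_measurable) (auto simp: L2_def)
  have D[measurable]: "D \<in> borel_measurable PM"
    unfolding D_def V_def by (rule Leibniz_det_measurable) (use v in measurable)
  define E where "E x i j = Leibniz_det k ((V x)(i := (\<lambda>l. if l = j then 1 else 0)))" for x i j
  have E[measurable]: "(\<lambda>x. E x i j) \<in> borel_measurable PM" for i j
    unfolding E_def V_def
  proof (rule Leibniz_det_measurable)
    fix a l assume "a < k" "l < k"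
    then show "(\<lambda>x. ((\<lambda>i j. v i (x j))(i := (\<lambda>l. if l = j then 1 else 0))) a l) \<in> borel_measurable PM"
      using v by (cases "a = i") auto
  qed
  define P where "P = density PM (\<lambda>x. ennreal ((D x)\<^sup>2 / fact k))"
  define h where "h x i j = E x i j / D x" for x i j
  have "integrable PM (\<lambda>x. (D x)\<^sup>2)" and D2: "(LINT x|PM. (D x)\<^sup>2) = fact k"
    using integral_Leibniz_det_square[OF M, of k v] v vv by (auto simp: PM_def D_def V_def)
  then have "(\<integral>\<^sup>+x. ennreal ((D x)\<^sup>2 / fact k) \<partial>PM) = 1"
    by (subst nn_integral_eq_integral) auto
  then have "prob_space P"
    by (intro prob_spaceI) (simp add: P_def emeasure_density cong: nn_integral_cong)
  moreover have "sets P = sets PM" by (simp add: P_def)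
  moreover have "(\<lambda>x. h x i j) \<in> borel_measurable P" for i j
    unfolding P_def h_def by simp
  moreover have "(\<integral>\<^sup>+x. ennreal (\<Sum>i<k. ((\<Sum>j<k. h x i j * f (x j)) - L2_inner M f (v i))\<^sup>2) \<partial>P)
          \<le> ennreal (real k * (L2_norm M (residual M k v f))\<^sup>2)" (is "?lhs \<le> _") if f: "f \<in> L2 M" for f
  proof -
    let ?r = "residual M k v f" and ?a = "\<lambda>i. L2_inner M f (v i)"
    have sumL: "(\<lambda>x. \<Sum>i<k. ?a i * v i x) \<in> L2 M" using v by (intro L.sum_in) auto
    have r: "?r \<in> L2 M" unfolding residual_def by (rule L.diff_in[OF f sumL])
    have rv: "L2_inner M ?r (v j) = 0" if "j < k" for j
      unfolding residual_def using v vv f that by (subst L.orthonormal_residual) auto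
    have vr: "L2_inner M (v j) ?r = 0" if "j < k" for j using L.sym[OF v[OF that] r] rv[OF that] by simp
    define R where "R i x = Leibniz_det k ((V x)(i := (\<lambda>j. ?r (x j))))" for i x
    have R: "integrable PM (\<lambda>x. (R i x)\<^sup>2)" "(LINT x|PM. (R i x)\<^sup>2) = fact k * L2_inner M ?r ?r"
      if i: "i < k" for i
    proof -
      let ?g = "v(i := ?r)"
      have eq: "Leibniz_det k (\<lambda>a j. ?g a (x j)) = R i x" for x
        unfolding R_def V_def by (rule Leibniz_det_cong) auto
      have g: "?g a \<in> L2 M" if "a < k" for a using v r that by auto
      have orth: "L2_inner M (?g a) (?g j) = 0" if "a < k" "j < k" "a \<noteq> j" for a j
        using that rv vr vv by auto
      have int: "integrable (Pi\<^sub>M {..<k} (\<lambda>_. M)) (\<lambda>x. (Leibniz_det k (\<lambda>a j. ?g a (x j)))\<^sup>2)"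
        by (rule integral_Leibniz_det_square(1)[OF M]; (rule g | rule orth); assumption)
      have val: "(LINT x|Pi\<^sub>M {..<k} (\<lambda>_. M). (Leibniz_det k (\<lambda>a j. ?g a (x j)))\<^sup>2) =
          fact k * (\<Prod>a<k. L2_inner M (?g a) (?g a))"
        by (rule integral_Leibniz_det_square(2)[OF M]; (rule g | rule orth); assumption)
      have "(\<Prod>a<k. L2_inner M (?g a) (?g a)) = (\<Prod>a<k. if a = i then L2_inner M ?r ?r else 1)"
        using vv by (intro prod.cong) auto
      also have "\<dots> = L2_inner M ?r ?r" using i by simp
      finally show "integrable PM (\<lambda>x. (R i x)\<^sup>2)" "(LINT x|PM. (R i x)\<^sup>2) = fact k * L2_inner M ?r ?r"
        using int val unfolding eq PM_def by auto
    qed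
    have [measurable]: "R i \<in> borel_measurable PM" if "i < k" for i
      unfolding R_def V_def
    proof (rule Leibniz_det_measurable)
      fix a l assume "a < k" "l < k"
      then show "(\<lambda>x. ((\<lambda>i j. v i (x j))(i := (\<lambda>j. ?r (x j)))) a l) \<in> borel_measurable PM"
        using v r by (cases "a = i") auto
    qed
    have coeff: "(\<Sum>j<k. h x i j * f (x j)) - ?a i = R i x / D x" if i: "i < k" and nz: "D x \<noteq> 0" for x i
    proof -
      have f_split: "(\<lambda>j. f (x j)) = (\<lambda>j. ?r (x j) + (\<Sum>l<k. ?a l * V x l j))"
        by (simp add: residual_def V_def)
      have "(\<Sum>j<k. f (x j) * E x i j) = Leibniz_det k ((V x)(i := (\<lambda>j. f (x j))))"
        unfolding E_def by (rule Leibniz_det_expand_row[OF i, symmetric])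
      also have "\<dots> = R i x + ?a i * D x"
        unfolding f_split R_def D_def by (rule Leibniz_det_Cramer[OF i])
      finally have "(\<Sum>j<k. f (x j) * E x i j) = R i x + ?a i * D x" .
      moreover have "(\<Sum>j<k. h x i j * f (x j)) = (\<Sum>j<k. f (x j) * E x i j) / D x"
        by (simp add: h_def sum_divide_distrib mult.commute)
      ultimately have "(\<Sum>j<k. h x i j * f (x j)) = (R i x + ?a i * D x) / D x" by (simp only:)
      then show ?thesis using nz by (simp add: add_divide_distrib)
    qed
    have "?lhs = (\<integral>\<^sup>+x. ennreal ((D x)\<^sup>2 / fact k) *
        ennreal (\<Sum>i<k. ((\<Sum>j<k. h x i j * f (x j)) - ?a i)\<^sup>2) \<partial>PM)"
      unfolding P_def h_def using f by (intro nn_integral_density) auto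
    also have "\<dots> \<le> (\<integral>\<^sup>+x. ennreal (\<Sum>i<k. (R i x)\<^sup>2 / fact k) \<partial>PM)"
    proof (intro nn_integral_mono)
      fix x
      show "ennreal ((D x)\<^sup>2 / fact k) * ennreal (\<Sum>i<k. ((\<Sum>j<k. h x i j * f (x j)) - ?a i)\<^sup>2)
          \<le> ennreal (\<Sum>i<k. (R i x)\<^sup>2 / fact k)"
      proof (cases "D x = 0")
        case False
        have "(D x)\<^sup>2 / fact k * (\<Sum>i<k. ((\<Sum>j<k. h x i j * f (x j)) - ?a i)\<^sup>2) =
            (\<Sum>i<k. (R i x)\<^sup>2 / fact k)"
          unfolding sum_distrib_left using False
          by (intro sum.cong refl) (simp add: coeff power_divide)
        then show ?thesis by (simp flip: ennreal_mult' add: sum_nonneg)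
      qed simp
    qed
    also have "\<dots> = ennreal (LINT x|PM. (\<Sum>i<k. (R i x)\<^sup>2 / fact k))"
      using R by (intro nn_integral_eq_integral) (auto intro!: sum_nonneg)
    also have "(LINT x|PM. (\<Sum>i<k. (R i x)\<^sup>2 / fact k)) = (\<Sum>i<k. L2_inner M ?r ?r)"
      using R by (subst Bochner_Integration.integral_sum) auto
    also have "\<dots> = real k * (L2_norm M ?r)\<^sup>2" by (simp add: L2_norm_power2)
    finally show ?thesis .
  qed
  ultimately show ?thesis unfolding coefficient_scheme_def PM_def by blast
qed

section \<open>Importance sampling\<close>

text \<open>
  Cross terms vanish by independence, and a variance is at most the second moment.
\<close>

lemma sample_mean_square_error:
  fixes Z :: "'a \<Rightarrow> real"
  assumes Q: "prob_space Q" and Z: "Z \<in> L2 Q" and N: "0 < N"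
  shows "integrable (Pi\<^sub>M {..<N} (\<lambda>_. Q)) (\<lambda>y. ((\<Sum>l<N. Z (y l)) / real N - (LINT x|Q. Z x))\<^sup>2)" (is ?int)
    and "(LINT y|Pi\<^sub>M {..<N} (\<lambda>_. Q). ((\<Sum>l<N. Z (y l)) / real N - (LINT x|Q. Z x))\<^sup>2)
      \<le> (LINT x|Q. (Z x)\<^sup>2) / real N" (is ?le)
proof -
  interpret prob_space Q by (rule Q)
  interpret product_sigma_finite "\<lambda>_::nat. Q" ..
  interpret L: semi_inner "L2 Q" "L2_inner Q" by (rule semi_inner_L2)
  define \<mu> where "\<mu> = (LINT x|Q. Z x)"
  define Y where "Y = (\<lambda>x. Z x - \<mu>)"
  have one: "(\<lambda>x. c) \<in> L2 Q" for c by (simp add: L2_def)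
  have Y: "Y \<in> L2 Q" unfolding Y_def by (rule L.diff_in[OF Z one])
  have intZ: "integrable Q Z" using L2_mult_integrable[OF Z one[of 1]] by simp
  then have intY: "integrable Q Y" by (simp add: Y_def)
  have Y0: "(LINT x|Q. Y x) = 0" using intZ by (simp add: Y_def \<mu>_def prob_space)
  have YY: "(LINT x|Q. Y x * Y x) \<le> (LINT x|Q. (Z x)\<^sup>2)"
  proof -
    have "(LINT x|Q. Y x * Y x) = L2_inner Q Z Z - 2 * L2_inner Q Z (\<lambda>_. \<mu>) + L2_inner Q (\<lambda>_. \<mu>) (\<lambda>_. \<mu>)"
      using L.diff_diff[OF Z one[of \<mu>]] by (simp add: Y_def L2_inner_def)
    also have "L2_inner Q Z (\<lambda>_. \<mu>) = \<mu> * \<mu>" by (simp add: L2_inner_def \<mu>_def)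
    also have "L2_inner Q (\<lambda>_. \<mu>) (\<lambda>_. \<mu>) = \<mu> * \<mu>" by (simp add: L2_inner_def prob_space)
    finally show ?thesis by (simp add: L2_inner_def power2_eq_square)
  qed
  \<comment> \<open>\<open>Y (y l) * Y (y l')\<close> as a product over all coordinates, to integrate coordinate by coordinate\<close>
  define \<phi> where "\<phi> l l' j x = (if j = l then Y x else 1) * (if j = l' then Y x else 1)" for l l' j :: nat and x
  have prod\<phi>: "(\<Prod>j<N. \<phi> l l' j (y j)) = Y (y l) * Y (y l')" if "l < N" "l' < N" for l l' and y :: "nat \<Rightarrow> 'a"
    using that by (simp add: \<phi>_def prod.distrib)
  have int\<phi>: "integrable Q (\<phi> l l' j)" for l l' j
    using intY L2_mult_integrable[OF Y Y] by (cases "j = l"; cases "j = l'") (simp_all add: \<phi>_def[abs_def])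
  have cross_int: "integrable (Pi\<^sub>M {..<N} (\<lambda>_. Q)) (\<lambda>y. Y (y l) * Y (y l'))" if "l < N" "l' < N" for l l'
    using product_integrable_prod[of "{..<N}" "\<phi> l l'"] int\<phi> by (simp add: prod\<phi> that)
  have cross: "(LINT y|Pi\<^sub>M {..<N} (\<lambda>_. Q). Y (y l) * Y (y l')) = (if l = l' then (LINT x|Q. Y x * Y x) else 0)"
    if l: "l < N" "l' < N" for l l'
  proof -
    have "(LINT y|Pi\<^sub>M {..<N} (\<lambda>_. Q). Y (y l) * Y (y l')) = (\<Prod>j<N. LINT x|Q. \<phi> l l' j x)"
      using product_integral_prod[of "{..<N}" "\<phi> l l'"] int\<phi> by (simp add: prod\<phi> l)
    also have "\<dots> = (if l = l' then (LINT x|Q. Y x * Y x) else 0)"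
    proof (cases "l = l'")
      case True
      have "(\<Prod>j<N. LINT x|Q. \<phi> l l' j x) = (\<Prod>j<N. if j = l then (LINT x|Q. Y x * Y x) else 1)"
        using True by (intro prod.cong) (auto simp: \<phi>_def prob_space)
      then show ?thesis using True l by simp
    next
      case False
      then have "(LINT x|Q. \<phi> l l' l x) = 0" by (simp add: \<phi>_def Y0)
      then have "(\<Prod>j<N. LINT x|Q. \<phi> l l' j x) = 0" using l by (intro prod_zero) auto
      then show ?thesis using False by simp
    qed
    finally show ?thesis .
  qed
  have eq: "((\<Sum>l<N. Z (y l)) / real N - \<mu>)\<^sup>2 = (\<Sum>l<N. \<Sum>l'<N. Y (y l) * Y (y l')) / (real N)\<^sup>2" for y :: "nat \<Rightarrow> 'a"
  proof -
    have "(\<Sum>l<N. Z (y l)) / real N - \<mu> = (\<Sum>l<N. Y (y l)) / real N"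
      using N by (simp add: Y_def sum_subtractf field_simps)
    then show ?thesis by (simp add: power_divide power2_eq_square sum_product)
  qed
  have int2: "integrable (Pi\<^sub>M {..<N} (\<lambda>_. Q)) (\<lambda>y. \<Sum>l'<N. Y (y l) * Y (y l'))" if "l < N" for l
    using cross_int that by (intro Bochner_Integration.integrable_sum) auto
  show ?int unfolding \<mu>_def[symmetric] eq
    by (rule integrable_divide, rule Bochner_Integration.integrable_sum) (simp add: int2)
  have "(LINT y|Pi\<^sub>M {..<N} (\<lambda>_. Q). ((\<Sum>l<N. Z (y l)) / real N - \<mu>)\<^sup>2) =
      (LINT y|Pi\<^sub>M {..<N} (\<lambda>_. Q). (\<Sum>l<N. \<Sum>l'<N. Y (y l) * Y (y l'))) / (real N)\<^sup>2"
    unfolding eq by simp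
  also have "(LINT y|Pi\<^sub>M {..<N} (\<lambda>_. Q). (\<Sum>l<N. \<Sum>l'<N. Y (y l) * Y (y l'))) =
      (\<Sum>l<N. LINT y|Pi\<^sub>M {..<N} (\<lambda>_. Q). (\<Sum>l'<N. Y (y l) * Y (y l')))"
    by (rule Bochner_Integration.integral_sum) (simp add: int2)
  also have "\<dots> = (\<Sum>l<N. \<Sum>l'<N. LINT y|Pi\<^sub>M {..<N} (\<lambda>_. Q). Y (y l) * Y (y l'))"
    by (rule sum.cong[OF refl], rule Bochner_Integration.integral_sum) (simp add: cross_int)
  also have "\<dots> = (\<Sum>l<N. \<Sum>l'<N. if l = l' then (LINT x|Q. Y x * Y x) else 0)"
    by (intro sum.cong refl) (simp add: cross)
  also have "\<dots> = real N * (LINT x|Q. Y x * Y x)" by simp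
  also have "real N * (LINT x|Q. Y x * Y x) / (real N)\<^sup>2 = (LINT x|Q. Y x * Y x) / real N"
    using N by (simp add: power2_eq_square)
  also have "\<dots> \<le> (LINT x|Q. (Z x)\<^sup>2) / real N" using YY by (intro divide_right_mono) auto
  finally show ?le by (simp add: \<mu>_def)
qed

text \<open>
  The normalized leverage score (inverse Christoffel function), which is the density of the distribution from which the points of
  the corrections are drawn.
\<close>

definition leverage :: "nat \<Rightarrow> (nat \<Rightarrow> 'a \<Rightarrow> real) \<Rightarrow> 'a \<Rightarrow> real" where
  "leverage k v x = (\<Sum>i<k. (v i x)\<^sup>2) / real k"

definition leverage_measure :: "'a measure \<Rightarrow> nat \<Rightarrow> (nat \<Rightarrow> 'a \<Rightarrow> real) \<Rightarrow> 'a measure" where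
  "leverage_measure M k v = density M (\<lambda>x. ennreal (leverage k v x))"

lemma leverage_nonneg: "0 \<le> leverage k v x"
  by (simp add: leverage_def sum_nonneg)

lemma sum_squares_eq_leverage: "0 < k \<Longrightarrow> (\<Sum>i<k. (v i x)\<^sup>2) = real k * leverage k v x"
  by (simp add: leverage_def)

lemma square_le_leverage: "i < k \<Longrightarrow> (v i x)\<^sup>2 \<le> real k * leverage k v x"
  by (subst sum_squares_eq_leverage[symmetric]) (auto intro!: member_le_sum)

lemma leverage_measurable:
  assumes "orthonormal M k v"
  shows "leverage k v \<in> borel_measurable M"
proof -
  have "v i \<in> borel_measurable M" if "i < k" for i
    using assms that by (auto simp: orthonormal_def L2_def)
  then show ?thesis unfolding leverage_def[abs_def]
    by (intro borel_measurable_divide borel_measurable_sum borel_measurable_power) auto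
qed

lemma prob_space_leverage_measure:
  assumes on: "orthonormal M k v" and k: "0 < k"
  shows "prob_space (leverage_measure M k v)"
proof (rule prob_spaceI)
  have v: "integrable M (\<lambda>x. (v i x)\<^sup>2)" "(LINT x|M. (v i x)\<^sup>2) = 1" if "i < k" for i
    using on that by (auto simp: orthonormal_def L2_def L2_inner_def power2_eq_square)
  have "emeasure (leverage_measure M k v) (space (leverage_measure M k v)) = (\<integral>\<^sup>+x. ennreal (leverage k v x) \<partial>M)"
    using leverage_measurable[OF on]
    by (simp add: leverage_measure_def emeasure_density cong: nn_integral_cong)
  also have "\<dots> = ennreal (LINT x|M. leverage k v x)"
  proof (intro nn_integral_eq_integral AE_I2 leverage_nonneg)
    show "integrable M (leverage k v)" unfolding leverage_def[abs_def]
      by (rule integrable_divide, rule Bochner_Integration.integrable_sum) (simp add: v)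
  qed
  also have "(LINT x|M. leverage k v x) = 1"
    using v k by (simp add: leverage_def)
  finally show "emeasure (leverage_measure M k v) (space (leverage_measure M k v)) = 1" by simp
qed

text \<open>
  The sampling density \<open>w\<close> is chosen such that the second moments of the \<open>k\<close> estimators add up
  to at most \<open>k\<close> times the squared norm of \<open>g\<close>, because \<open>\<Sum>i<k. (v i)\<^sup>2 / w\<close> is the constant \<open>k\<close> where \<open>w\<close> does not
  vanish. Where \<open>w\<close> vanishes, all \<open>v i\<close> vanish too, and the quotients are zero by convention; hence the
  estimators stay unbiased.
\<close>

lemma importance_sampling:
  assumes on: "orthonormal M k v" and g: "g \<in> L2 M"
  shows "i < k \<Longrightarrow> (\<lambda>x. g x * v i x / leverage k v x) \<in> L2 (leverage_measure M k v)"
    and "i < k \<Longrightarrow> (LINT x|leverage_measure M k v. g x * v i x / leverage k v x) = L2_inner M g (v i)"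
    and "(\<Sum>i<k. LINT x|leverage_measure M k v. (g x * v i x / leverage k v x)\<^sup>2) \<le> real k * L2_inner M g g"
proof -
  let ?w = "leverage k v"
  have w[measurable]: "?w \<in> borel_measurable M" by (rule leverage_measurable[OF on])
  have v: "v i \<in> borel_measurable M" if "i < k" for i
    using on that by (auto simp: orthonormal_def L2_def)
  have gm[measurable]: "g \<in> borel_measurable M" and g2: "integrable M (\<lambda>x. (g x)\<^sup>2)"
    using g by (auto simp: L2_def)
  have zero: "v i x = 0" if "i < k" "?w x = 0" for i x
    using square_le_leverage[OF that(1), of v x] that(2) by simp
  have sq: "?w x * (g x * v i x / ?w x)\<^sup>2 = (g x)\<^sup>2 * ((v i x)\<^sup>2 / ?w x)" for i x
    by (simp add: power2_eq_square)
  have ratio: "(v i x)\<^sup>2 / ?w x \<le> real k" if "i < k" for i x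
    using square_le_leverage[OF that, of v x] leverage_nonneg[of k v x]
    by (cases "?w x = 0") (auto simp: pos_divide_le_eq)
  have int: "integrable M (\<lambda>x. ?w x * (g x * v i x / ?w x)\<^sup>2)" if i: "i < k" for i
  proof (rule Bochner_Integration.integrable_bound)
    show "integrable M (\<lambda>x. (g x)\<^sup>2 * real k)" using g2 by simp
    show "(\<lambda>x. ?w x * (g x * v i x / ?w x)\<^sup>2) \<in> borel_measurable M" using v[OF i] by simp
    show "AE x in M. norm (?w x * (g x * v i x / ?w x)\<^sup>2) \<le> norm ((g x)\<^sup>2 * real k)"
    proof (rule AE_I2)
      fix x
      have "?w x * (g x * v i x / ?w x)\<^sup>2 \<le> (g x)\<^sup>2 * real k"
        unfolding sq using ratio[OF i] by (intro mult_left_mono) auto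
      then show "norm (?w x * (g x * v i x / ?w x)\<^sup>2) \<le> norm ((g x)\<^sup>2 * real k)"
        using leverage_nonneg[of k v x] by simp
    qed
  qed
  have measQ: "(\<lambda>x. g x * v i x / ?w x) \<in> borel_measurable M" if "i < k" for i
    using v[OF that] by simp
  show "(\<lambda>x. g x * v i x / ?w x) \<in> L2 (leverage_measure M k v)" if i: "i < k" for i
    unfolding L2_def leverage_measure_def using int[OF i] measQ[OF i] leverage_nonneg[of k v]
    by (auto simp: integrable_real_density)
  show "(LINT x|leverage_measure M k v. g x * v i x / ?w x) = L2_inner M g (v i)" if i: "i < k" for i
  proof -
    have "(LINT x|leverage_measure M k v. g x * v i x / ?w x) = (LINT x|M. ?w x * (g x * v i x / ?w x))"
      unfolding leverage_measure_def using measQ[OF i] leverage_nonneg[of k v]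
      by (intro integral_real_density) auto
    also have "\<dots> = L2_inner M g (v i)"
      unfolding L2_inner_def using zero[OF i] by (intro Bochner_Integration.integral_cong) auto
    finally show ?thesis .
  qed
  have "(\<Sum>i<k. LINT x|leverage_measure M k v. (g x * v i x / ?w x)\<^sup>2) =
      (\<Sum>i<k. LINT x|M. ?w x * (g x * v i x / ?w x)\<^sup>2)"
    unfolding leverage_measure_def using measQ leverage_nonneg[of k v]
    by (intro sum.cong refl integral_real_density) auto
  also have "\<dots> = (LINT x|M. (\<Sum>i<k. ?w x * (g x * v i x / ?w x)\<^sup>2))"
    using int by (intro Bochner_Integration.integral_sum[symmetric]) auto
  also have "\<dots> \<le> (LINT x|M. (g x)\<^sup>2 * real k)"
  proof (rule integral_mono)
    show "integrable M (\<lambda>x. \<Sum>i<k. ?w x * (g x * v i x / ?w x)\<^sup>2)"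
      using int by (intro Bochner_Integration.integrable_sum) auto
    show "integrable M (\<lambda>x. (g x)\<^sup>2 * real k)" using g2 by simp
    fix x
    have "(\<Sum>i<k. ?w x * (g x * v i x / ?w x)\<^sup>2) = (g x)\<^sup>2 * ((\<Sum>i<k. (v i x)\<^sup>2) / ?w x)"
      unfolding sq by (simp add: sum_distrib_left sum_divide_distrib)
    also have "\<dots> \<le> (g x)\<^sup>2 * real k"
    proof (intro mult_left_mono)
      show "(\<Sum>i<k. (v i x)\<^sup>2) / ?w x \<le> real k"
        by (cases "k = 0"; cases "?w x = 0") (auto simp: sum_squares_eq_leverage)
    qed auto
    finally show "(\<Sum>i<k. ?w x * (g x * v i x / ?w x)\<^sup>2) \<le> (g x)\<^sup>2 * real k" .
  qed
  also have "\<dots> = real k * L2_inner M g g" by (simp add: L2_inner_def power2_eq_square)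
  finally show "(\<Sum>i<k. LINT x|leverage_measure M k v. (g x * v i x / ?w x)\<^sup>2) \<le> real k * L2_inner M g g" .
qed

section \<open>Monte Carlo correction of a scheme\<close>

lemma sum_lessThan_add:
  fixes u :: "nat \<Rightarrow> real"
  shows "(\<Sum>j<n + N. u j) = (\<Sum>j<n. u j) + (\<Sum>l<N. u (n + l))"
  by (induction N) (simp_all add: add.assoc)

text \<open>
  Given the points \<open>x\<close> of the first scheme and its coefficients \<open>c x\<close>, the function
  \<open>g x = f - (\<Sum>m<k. c x m * v m)\<close> is known at every new point at the cost of one value of \<open>f\<close>. Its coefficients are exactly
  the errors of \<open>c x\<close>; adding unbiased estimates of them leaves only the sampling error,
  whose mean square is at most \<open>k / N\<close> times the squared norm of \<open>g x\<close>. By the theorem of Pythagoras, the latter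
  is the squared norm of the residual plus the squared error of \<open>c x\<close>.
\<close>

lemma Monte_Carlo_correction:
  assumes M: "prob_space M" and on: "orthonormal M k v" and k: "0 < k" and N: "0 < N" and \<beta>: "0 \<le> \<beta>"
    and cs: "coefficient_scheme M k v n \<beta>"
  shows "coefficient_scheme M k v (n + N) (real k / real N * (1 + \<beta>))"
proof -
  interpret L: semi_inner "L2 M" "L2_inner M" by (rule semi_inner_L2)
  have v: "v i \<in> L2 M" if "i < k" for i using on that by (auto simp: orthonormal_def)
  have vv: "L2_inner M (v i) (v j) = (if i = j then 1 else 0)" if "i < k" "j < k" for i j
    using on that by (auto simp: orthonormal_def)
  obtain P h where Ph: "prob_space P \<and> sets P = sets (Pi\<^sub>M {..<n} (\<lambda>_. M)) \<and>
       (\<forall>i<k. \<forall>j<n. (\<lambda>x. h x i j) \<in> borel_measurable P) \<and>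
       (\<forall>f\<in>L2 M. (\<integral>\<^sup>+x. ennreal (\<Sum>i<k. ((\<Sum>j<n. h x i j * f (x j)) - L2_inner M f (v i))\<^sup>2) \<partial>P)
          \<le> ennreal (\<beta> * (L2_norm M (residual M k v f))\<^sup>2))"
    using cs unfolding coefficient_scheme_def by (elim exE)
  have P: "prob_space P" and setsP: "sets P = sets (Pi\<^sub>M {..<n} (\<lambda>_. M))"
    and h: "i < k \<Longrightarrow> j < n \<Longrightarrow> (\<lambda>x. h x i j) \<in> borel_measurable P"
    and err: "f \<in> L2 M \<Longrightarrow> (\<integral>\<^sup>+x. ennreal (\<Sum>i<k. ((\<Sum>j<n. h x i j * f (x j)) - L2_inner M f (v i))\<^sup>2) \<partial>P)
          \<le> ennreal (\<beta> * (L2_norm M (residual M k v f))\<^sup>2)" for i j f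
    using Ph by auto
  define Q where "Q = leverage_measure M k v"
  define R where "R = Pi\<^sub>M {..<N} (\<lambda>_. Q)"
  let ?w = "leverage k v"
  have Q: "prob_space Q" unfolding Q_def by (rule prob_space_leverage_measure[OF on k])
  interpret P: prob_space P by (rule P)
  interpret R: prob_space R unfolding R_def by (rule prob_space_PiM) (rule Q)
  interpret PR: pair_prob_space P R ..
  have setsR: "sets R = sets (Pi\<^sub>M {..<N} (\<lambda>_. M))"
    unfolding R_def by (rule sets_PiM_cong) (auto simp: Q_def leverage_measure_def)
  define PM where "PM = Pi\<^sub>M {..<n + N} (\<lambda>_. M)"
  define J where "J = (\<lambda>(x, y). \<lambda>j\<in>{..<n + N}. if j < n then x j else y (j - n) :: 'a)"
  have J: "J \<in> measurable (P \<Otimes>\<^sub>M R) PM"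
    unfolding PM_def J_def split_beta'
  proof (rule measurable_restrict)
    fix j assume j: "j \<in> {..<n + N}"
    show "(\<lambda>z. if j < n then fst z j else snd z (j - n)) \<in> measurable (P \<Otimes>\<^sub>M R) M"
    proof (cases "j < n")
      case True
      have "(\<lambda>x. x j) \<in> measurable P M"
        using True by (simp add: measurable_cong_sets[OF setsP refl])
      then show ?thesis using True by simp
    next
      case False
      have "(\<lambda>x. x (j - n)) \<in> measurable R M"
        using False j by (simp add: measurable_cong_sets[OF setsR refl])
      then show ?thesis using False by simp
    qed
  qed
  define P' where "P' = distr (P \<Otimes>\<^sub>M R) PM J"
  have P': "prob_space P'" unfolding P'_def by (rule PR.prob_space_distr[OF J])
  have setsP': "sets P' = sets PM" by (simp add: P'_def)
  \<comment> \<open>weights of the corrected coefficients: old points enter through \<open>c x\<close> and through \<open>g x\<close>, new ones through \<open>f\<close>\<close>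
  define h' where "h' z i j = (if j < n then
      h (restrict z {..<n}) i j - (\<Sum>l<N. \<Sum>m<k. h (restrict z {..<n}) m j * (v m (z (n + l)) * v i (z (n + l)) / ?w (z (n + l)))) / real N
      else v i (z j) / ?w (z j) / real N)" for z i j
  have comp: "(\<lambda>z. f (z j)) \<in> borel_measurable PM" if "f \<in> borel_measurable M" "j < n + N" for f j
    unfolding PM_def using that by (rule coordinate_measurable)
  have vm: "v i \<in> borel_measurable M" if "i < k" for i using v[OF that] by (auto simp: L2_def)
  have wm: "?w \<in> borel_measurable M" by (rule leverage_measurable[OF on])
  have hr: "(\<lambda>z. h (restrict z {..<n}) i j) \<in> borel_measurable PM" if "i < k" "j < n" for i j
  proof (rule measurable_compose[of "\<lambda>z. restrict z {..<n}" PM P])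
    show "(\<lambda>z. restrict z {..<n}) \<in> measurable PM P"
      unfolding PM_def measurable_cong_sets[OF refl setsP] by (rule measurable_restrict_subset) auto
  qed (rule h[OF that])
  have h': "(\<lambda>z. h' z i j) \<in> borel_measurable PM" if i: "i < k" and j: "j < n + N" for i j
  proof (cases "j < n")
    case True
    have "(\<lambda>z. h (restrict z {..<n}) m j * (v m (z (n + l)) * v i (z (n + l)) / ?w (z (n + l)))) \<in> borel_measurable PM"
      if "m < k" "l < N" for m l
      using hr[OF that(1) True] comp[OF vm[OF i], of "n + l"] comp[OF vm[OF that(1)], of "n + l"] comp[OF wm, of "n + l"] that
      by (intro borel_measurable_times borel_measurable_divide) auto
    then show ?thesis using True hr[OF i True] unfolding h'_def
      by (auto intro!: borel_measurable_diff borel_measurable_divide borel_measurable_sum)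
  next
    case False
    then show ?thesis using comp[OF vm[OF i] j] comp[OF wm j] unfolding h'_def by simp
  qed
  have step: "(\<integral>\<^sup>+z. ennreal (\<Sum>i<k. ((\<Sum>j<n + N. h' z i j * f (z j)) - L2_inner M f (v i))\<^sup>2) \<partial>P')
      \<le> ennreal (real k / real N * (1 + \<beta>) * (L2_norm M (residual M k v f))\<^sup>2)"
    if f: "f \<in> L2 M" for f
  proof -
    let ?a = "\<lambda>i. L2_inner M f (v i)" and ?r = "residual M k v f"
    define c where "c x i = (\<Sum>j<n. h x i j * f (x j))" for x i
    define g where "g x = (\<lambda>t. f t - (\<Sum>m<k. c x m * v m t))" for x
    define Z where "Z x i = (\<lambda>t. g x t * v i t / ?w t)" for x i
    have fm: "f \<in> borel_measurable M" using f by (auto simp: L2_def)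
    have sumL: "(\<lambda>t. \<Sum>m<k. c x m * v m t) \<in> L2 M" for x using v by (intro L.sum_in) auto
    have gL: "g x \<in> L2 M" for x unfolding g_def by (rule L.diff_in[OF f sumL])
    have gv: "L2_inner M (g x) (v i) = ?a i - c x i" if "i < k" for x i
      unfolding g_def using v vv f that by (intro L.orthonormal_residual) auto
    have gg: "L2_inner M (g x) (g x) = (L2_norm M ?r)\<^sup>2 + (\<Sum>i<k. (c x i - ?a i)\<^sup>2)" for x
      unfolding g_def L2_norm_power2 residual_def using v vv f by (intro L.Pythagoras) auto
    have coeff_error: "(\<Sum>j<n + N. h' (J (x, y)) i j * f (J (x, y) j)) - ?a i =
        (\<Sum>l<N. Z x i (y l)) / real N - L2_inner M (g x) (v i)"
      if x: "x \<in> space P" and i: "i < k" for x y i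
    proof -
      have "x \<in> extensional {..<n}"
        using x sets_eq_imp_space_eq[OF setsP] by (auto simp: space_PiM PiE_def)
      then have res: "restrict (J (x, y)) {..<n} = x"
        by (auto simp: J_def extensional_def fun_eq_iff restrict_def)
      have Jy: "J (x, y) (n + l) = y l" if "l < N" for l using that by (simp add: J_def)
      have Jx: "J (x, y) j = x j" if "j < n" for j using that by (simp add: J_def)
      let ?u = "\<lambda>l m. v m (y l) * v i (y l) / ?w (y l)"
      have "(\<Sum>j<n + N. h' (J (x, y)) i j * f (J (x, y) j)) =
          (\<Sum>j<n. h' (J (x, y)) i j * f (x j)) + (\<Sum>l<N. h' (J (x, y)) i (n + l) * f (y l))"
        by (simp add: sum_lessThan_add Jx Jy)
      also have "(\<Sum>j<n. h' (J (x, y)) i j * f (x j)) =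
          (\<Sum>j<n. h x i j * f (x j) - (\<Sum>l<N. \<Sum>m<k. (h x m j * f (x j)) * ?u l m) / real N)"
      proof (intro sum.cong refl)
        fix j assume "j \<in> {..<n}"
        then have "h' (J (x, y)) i j = h x i j - (\<Sum>l<N. \<Sum>m<k. h x m j * ?u l m) / real N"
          by (simp add: h'_def res Jy)
        moreover have "(\<Sum>l<N. \<Sum>m<k. h x m j * ?u l m) * f (x j) = (\<Sum>l<N. \<Sum>m<k. (h x m j * f (x j)) * ?u l m)"
          unfolding sum_distrib_right by (intro sum.cong refl) (simp only: mult_ac)
        ultimately show "h' (J (x, y)) i j * f (x j) =
            h x i j * f (x j) - (\<Sum>l<N. \<Sum>m<k. (h x m j * f (x j)) * ?u l m) / real N"
          by (simp only: left_diff_distrib times_divide_eq_left)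
      qed
      also have "\<dots> = c x i - (\<Sum>j<n. \<Sum>l<N. \<Sum>m<k. (h x m j * f (x j)) * ?u l m) / real N"
        by (simp add: sum_subtractf sum_divide_distrib c_def)
      also have "(\<Sum>j<n. \<Sum>l<N. \<Sum>m<k. (h x m j * f (x j)) * ?u l m) = (\<Sum>l<N. \<Sum>m<k. c x m * ?u l m)"
        unfolding c_def sum_distrib_right
        by (subst sum.swap) (intro sum.cong refl sum.swap)
      also have "(\<Sum>l<N. h' (J (x, y)) i (n + l) * f (y l)) = (\<Sum>l<N. f (y l) * v i (y l) / ?w (y l)) / real N"
        by (simp add: h'_def Jy sum_divide_distrib mult.commute)
      also have "c x i - (\<Sum>l<N. \<Sum>m<k. c x m * ?u l m) / real N + (\<Sum>l<N. f (y l) * v i (y l) / ?w (y l)) / real N =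
          c x i + (\<Sum>l<N. Z x i (y l)) / real N"
      proof -
        have "Z x i t = f t * v i t / ?w t - (\<Sum>m<k. c x m * (v m t * v i t / ?w t))" for t
          by (simp add: Z_def g_def left_diff_distrib diff_divide_distrib sum_distrib_right sum_divide_distrib mult.assoc)
        then show ?thesis by (simp add: sum_subtractf diff_divide_distrib)
      qed
      finally show ?thesis using gv[OF i] by simp
    qed
    have inner: "(\<integral>\<^sup>+y. ennreal (\<Sum>i<k. ((\<Sum>l<N. Z x i (y l)) / real N - L2_inner M (g x) (v i))\<^sup>2) \<partial>R)
        \<le> ennreal (real k / real N * ((L2_norm M ?r)\<^sup>2 + (\<Sum>i<k. (c x i - ?a i)\<^sup>2)))" for x
    proof -
      have ZL: "Z x i \<in> L2 Q" "(LINT t|Q. Z x i t) = L2_inner M (g x) (v i)" if "i < k" for i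
        unfolding Z_def Q_def using importance_sampling(1,2)[OF on gL that] by auto
      have int: "integrable R (\<lambda>y. ((\<Sum>l<N. Z x i (y l)) / real N - L2_inner M (g x) (v i))\<^sup>2)"
        and le: "(LINT y|R. ((\<Sum>l<N. Z x i (y l)) / real N - L2_inner M (g x) (v i))\<^sup>2) \<le> (LINT t|Q. (Z x i t)\<^sup>2) / real N"
        if "i < k" for i
        using sample_mean_square_error[OF Q ZL(1)[OF that] N] unfolding R_def ZL(2)[OF that] by auto
      have "(\<integral>\<^sup>+y. ennreal (\<Sum>i<k. ((\<Sum>l<N. Z x i (y l)) / real N - L2_inner M (g x) (v i))\<^sup>2) \<partial>R) =
          ennreal (LINT y|R. (\<Sum>i<k. ((\<Sum>l<N. Z x i (y l)) / real N - L2_inner M (g x) (v i))\<^sup>2))"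
        using int by (intro nn_integral_eq_integral Bochner_Integration.integrable_sum) (auto intro!: sum_nonneg)
      also have "\<dots> \<le> ennreal (real k / real N * L2_inner M (g x) (g x))"
      proof (rule ennreal_leI)
        have "(LINT y|R. (\<Sum>i<k. ((\<Sum>l<N. Z x i (y l)) / real N - L2_inner M (g x) (v i))\<^sup>2)) =
            (\<Sum>i<k. LINT y|R. ((\<Sum>l<N. Z x i (y l)) / real N - L2_inner M (g x) (v i))\<^sup>2)"
          using int by (intro Bochner_Integration.integral_sum) auto
        also have "\<dots> \<le> (\<Sum>i<k. (LINT t|Q. (Z x i t)\<^sup>2) / real N)"
          using le by (intro sum_mono) auto
        also have "\<dots> = (\<Sum>i<k. LINT t|Q. (Z x i t)\<^sup>2) / real N" by (simp add: sum_divide_distrib)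
        also have "\<dots> \<le> (real k * L2_inner M (g x) (g x)) / real N"
          unfolding Z_def Q_def by (intro divide_right_mono importance_sampling(3)[OF on gL]) auto
        finally show "(LINT y|R. (\<Sum>i<k. ((\<Sum>l<N. Z x i (y l)) / real N - L2_inner M (g x) (v i))\<^sup>2))
            \<le> real k / real N * L2_inner M (g x) (g x)" by simp
      qed
      finally show ?thesis by (simp only: gg)
    qed
    have cm: "(\<lambda>x. c x i) \<in> borel_measurable P" if "i < k" for i
      unfolding c_def
    proof (rule borel_measurable_sum)
      fix j assume "j \<in> {..<n}"
      then show "(\<lambda>x. h x i j * f (x j)) \<in> borel_measurable P"
        using h[OF that] coordinate_measurable[OF fm, of j n]
        by (intro borel_measurable_times) (auto simp: measurable_cong_sets[OF setsP refl])
    qed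
    let ?H = "\<lambda>z. ennreal (\<Sum>i<k. ((\<Sum>j<n + N. h' z i j * f (z j)) - ?a i)\<^sup>2)"
    have "(\<lambda>z. (\<Sum>i<k. ((\<Sum>j<n + N. h' z i j * f (z j)) - ?a i)\<^sup>2)) \<in> borel_measurable PM"
      using h' comp[OF fm]
      by (intro borel_measurable_sum borel_measurable_power borel_measurable_diff borel_measurable_times) auto
    then have H: "?H \<in> borel_measurable PM" by (rule measurable_compose) simp
    have HJ: "(\<lambda>z. ?H (J z)) \<in> borel_measurable (P \<Otimes>\<^sub>M R)" using measurable_compose[OF J H] .
    have "(\<integral>\<^sup>+z. ?H z \<partial>P') = (\<integral>\<^sup>+z. ?H (J z) \<partial>(P \<Otimes>\<^sub>M R))"
      unfolding P'_def by (rule nn_integral_distr[OF J]) (use H in simp)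
    also have "\<dots> = (\<integral>\<^sup>+x. \<integral>\<^sup>+y. ?H (J (x, y)) \<partial>R \<partial>P)"
      by (rule R.nn_integral_fst[OF HJ, symmetric])
    also have "\<dots> = (\<integral>\<^sup>+x. \<integral>\<^sup>+y. ennreal (\<Sum>i<k. ((\<Sum>l<N. Z x i (y l)) / real N - L2_inner M (g x) (v i))\<^sup>2) \<partial>R \<partial>P)"
      by (intro nn_integral_cong arg_cong[of _ _ ennreal] sum.cong refl arg_cong[of _ _ "\<lambda>t. t\<^sup>2"])
         (auto intro!: coeff_error)
    also have "\<dots> \<le> (\<integral>\<^sup>+x. ennreal (real k / real N * ((L2_norm M ?r)\<^sup>2 + (\<Sum>i<k. (c x i - ?a i)\<^sup>2))) \<partial>P)"
      by (intro nn_integral_mono inner)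
    also have "\<dots> = (\<integral>\<^sup>+x. ennreal (real k / real N) * (ennreal ((L2_norm M ?r)\<^sup>2) + ennreal (\<Sum>i<k. (c x i - ?a i)\<^sup>2)) \<partial>P)"
      by (intro nn_integral_cong) (simp only: ennreal_mult' ennreal_plus[symmetric] sum_nonneg zero_le_power2
          divide_nonneg_nonneg of_nat_0_le_iff add_nonneg_nonneg)
    also have "\<dots> = ennreal (real k / real N) * (ennreal ((L2_norm M ?r)\<^sup>2) + (\<integral>\<^sup>+x. ennreal (\<Sum>i<k. (c x i - ?a i)\<^sup>2) \<partial>P))"
      using cm by (subst nn_integral_cmult, simp, subst nn_integral_add) (auto simp: P.emeasure_space_1)
    also have "\<dots> \<le> ennreal (real k / real N) * (ennreal ((L2_norm M ?r)\<^sup>2) + ennreal (\<beta> * (L2_norm M ?r)\<^sup>2))"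
      unfolding c_def by (intro mult_left_mono add_left_mono err[OF f]) auto
    also have "\<dots> = ennreal (real k / real N * (1 + \<beta>) * (L2_norm M ?r)\<^sup>2)"
      using \<beta> by (simp add: ennreal_mult' ring_distribs flip: ennreal_plus ennreal_mult')
    finally show ?thesis .
  qed
  show ?thesis
    unfolding coefficient_scheme_def
  proof (intro exI[of _ P'] exI[of _ h'] conjI allI impI ballI)
    show "sets P' = sets (Pi\<^sub>M {..<n + N} (\<lambda>_. M))" using setsP' by (simp add: PM_def)
    show "(\<lambda>x. h' x i j) \<in> borel_measurable P'" if "i < k" "j < n + N" for i j
      using h'[OF that] by (simp add: measurable_cong_sets[OF setsP' refl])
  qed (fact P' step)+
qed

section \<open>Sample sizes\<close>

lemma coefficient_scheme_mono:
  assumes "coefficient_scheme M k v n \<beta>" "\<beta> \<le> \<beta>'"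
  shows "coefficient_scheme M k v n \<beta>'"
proof -
  have le: "ennreal (\<beta> * (L2_norm M (residual M k v f))\<^sup>2) \<le> ennreal (\<beta>' * (L2_norm M (residual M k v f))\<^sup>2)" for f
    using assms(2) by (intro ennreal_leI mult_right_mono) auto
  show ?thesis using assms(1) unfolding coefficient_scheme_def
    by (elim ex_forward conj_forward) (auto intro: order_trans[OF _ le])
qed

lemma coefficient_scheme_trivial:
  "coefficient_scheme M 0 v 0 0"
proof -
  let ?P = "return (Pi\<^sub>M {..<0::nat} (\<lambda>_. M)) (\<lambda>_. undefined)"
  have "prob_space ?P" by (rule prob_space_return) (simp add: space_PiM)
  then show ?thesis unfolding coefficient_scheme_def
    by (intro exI[of _ ?P] exI[of _ "\<lambda>_ _ _. 0"]) auto
qed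

text \<open>
  With \<open>3 * m\<close> points a correction maps \<open>\<beta>\<close> to at most \<open>(1 + \<beta>) / 3\<close>, which has the fixed point \<open>1 / 2\<close> and contracts
  by the factor \<open>1 / 3\<close>. The choice of \<open>3\<close> makes \<open>exp 1 \<le> 3\<close> available, so that \<open>\<lceil>ln (m + 1)\<rceil>\<close> steps suffice to
  absorb the initial \<open>k \<le> m\<close>.
\<close>

lemma iterated_Monte_Carlo:
  assumes M: "prob_space M" and on: "orthonormal M k v" and k: "0 < k" "k \<le> m"
  shows "coefficient_scheme M k v (k + s * (3 * m)) (1 / 2 + real k / 3 ^ s)"
proof (induction s)
  case 0
  show ?case using volume_sampling[OF M on] by (auto intro: coefficient_scheme_mono)
next
  case (Suc s)
  have "coefficient_scheme M k v (k + s * (3 * m) + 3 * m)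
      (real k / real (3 * m) * (1 + (1 / 2 + real k / 3 ^ s)))"
    using k by (intro Monte_Carlo_correction[OF M on] Suc.IH) auto
  moreover have "real k / real (3 * m) * (1 + (1 / 2 + real k / 3 ^ s)) \<le> 1 / 3 * (1 + (1 / 2 + real k / 3 ^ s))"
    using k by (intro mult_right_mono) (auto simp: field_simps)
  ultimately have "coefficient_scheme M k v (k + s * (3 * m) + 3 * m) (1 / 3 * (1 + (1 / 2 + real k / 3 ^ s)))"
    by (rule coefficient_scheme_mono)
  then show ?case by (simp add: field_simps add.assoc)
qed

lemma constant_factor_scheme:
  assumes M: "prob_space M" and on: "orthonormal M k v" and k: "k \<le> m"
  shows "\<exists>n \<le> m + nat \<lceil>ln (real m + 1)\<rceil> * (3 * m). coefficient_scheme M k v n (3 / 2)"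
proof (cases "k = 0")
  case True
  then show ?thesis
    using coefficient_scheme_mono[OF coefficient_scheme_trivial, of "3 / 2" M v]
    by (intro exI[of _ 0]) simp
next
  case False
  let ?s = "nat \<lceil>ln (real m + 1)\<rceil>"
  have "real k \<le> real m + 1" using k by simp
  also have "\<dots> = exp (ln (real m + 1))" by simp
  also have "\<dots> \<le> exp (real ?s)" by (subst exp_le_cancel_iff) (rule of_nat_ceiling)
  also have "\<dots> = exp 1 ^ ?s" by (simp flip: exp_of_nat_mult)
  also have "\<dots> \<le> 3 ^ ?s" by (intro power_mono exp_le) simp
  finally have "1 / 2 + real k / 3 ^ ?s \<le> 3 / 2" by (simp add: field_simps)
  then have "coefficient_scheme M k v (k + ?s * (3 * m)) (3 / 2)"
    using iterated_Monte_Carlo[OF M on _ k, of ?s] False by (auto intro: coefficient_scheme_mono)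
  then show ?thesis using k by (intro exI[of _ "k + ?s * (3 * m)"]) auto
qed

text \<open>
  One final correction of the scheme with \<open>\<beta> = 3 / 2\<close>; the constant \<open>30\<close> is \<open>(1 + 3 / 2) * 12\<close>.
\<close>

lemma near_optimal_scheme:
  assumes M: "prob_space M" and on: "orthonormal M k v" and k: "k \<le> m" and L: "0 < L"
  shows "\<exists>n \<le> m + nat \<lceil>ln (real m + 1)\<rceil> * (3 * m) + nat \<lceil>30 * L\<rceil> * m.
    coefficient_scheme M k v n (1 / (12 * L))"
proof (cases "k = 0")
  case True
  then show ?thesis
    using coefficient_scheme_mono[OF coefficient_scheme_trivial, of "1 / (12 * L)" M v] L
    by (intro exI[of _ 0]) simp
next
  case False
  let ?N = "nat \<lceil>30 * L\<rceil> * m"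
  obtain n where n: "n \<le> m + nat \<lceil>ln (real m + 1)\<rceil> * (3 * m)" "coefficient_scheme M k v n (3 / 2)"
    using constant_factor_scheme[OF M on k] by blast
  have ceil: "30 * L \<le> real (nat \<lceil>30 * L\<rceil>)" by (rule of_nat_ceiling)
  then have pos: "0 < real (nat \<lceil>30 * L\<rceil>)" using L by linarith
  have "coefficient_scheme M k v (n + ?N) (real k / real ?N * (1 + 3 / 2))"
    using False k pos n by (intro Monte_Carlo_correction[OF M on]) auto
  moreover have "real k / real ?N * (1 + 3 / 2) \<le> 1 / (12 * L)"
  proof -
    have "real k / real ?N \<le> real m / real ?N" using k by (intro divide_right_mono) auto
    also have "\<dots> = 1 / real (nat \<lceil>30 * L\<rceil>)" using False k by simp
    also have "\<dots> \<le> 1 / (30 * L)" using ceil L by (intro divide_left_mono) auto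
    finally show ?thesis by simp
  qed
  ultimately have "coefficient_scheme M k v (n + ?N) (1 / (12 * L))"
    by (rule coefficient_scheme_mono)
  then show ?thesis using n by (intro exI[of _ "n + ?N"]) auto
qed

section \<open>From schemes to randomized methods\<close>

lemma L2_inner_orthonormal_combination:
  assumes "orthonormal M k v"
  shows "L2_inner M (\<lambda>t. \<Sum>i<k. c i * v i t) (\<lambda>t. \<Sum>i<k. c i * v i t) = (\<Sum>i<k. (c i)\<^sup>2)"
proof -
  interpret L: semi_inner "L2 M" "L2_inner M" by (rule semi_inner_L2)
  have v: "v i \<in> L2 M" if "i < k" for i using assms that by (auto simp: orthonormal_def)
  have 0: "L2_inner M (\<lambda>t. 0) g = 0" for g by (simp add: L2_inner_def)
  have "L2_inner M (\<lambda>t. 0 - (\<Sum>i<k. (- c i) * v i t)) (\<lambda>t. 0 - (\<Sum>i<k. (- c i) * v i t)) = (\<Sum>i<k. (c i)\<^sup>2)"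
    by (subst L.Pythagoras) (use v assms in \<open>auto simp: 0 L.zero_in orthonormal_def\<close>)
  then show ?thesis by (simp add: sum_negf)
qed

text \<open>
  The map from coefficients to functions is an isometry on a finite-dimensional space, so that preimages of \<open>L\<^sub>2\<close>-open
  sets are open for the product topology on sequences, whose Borel sets are the product \<open>\<sigma>\<close>-algebra.
\<close>

lemma orthonormal_combination_measurable:
  assumes on: "orthonormal M k v" and C: "\<And>i. i < k \<Longrightarrow> C i \<in> borel_measurable N"
  shows "(\<lambda>y t. \<Sum>i<k. C i y * v i t) \<in> measurable N (L2_borel M)"
proof -
  interpret L: semi_inner "L2 M" "L2_inner M" by (rule semi_inner_L2)
  have v: "v i \<in> L2 M" if "i < k" for i using on that by (auto simp: orthonormal_def)
  define W where "W c = (\<lambda>t. \<Sum>i<k. c i * v i t)" for c :: "nat \<Rightarrow> real"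
  have W: "W c \<in> L2 M" for c unfolding W_def using v by (intro L.sum_in) auto
  define \<Gamma> where "\<Gamma> y = (\<lambda>i. if i < k then C i y else 0)" for y
  have \<Gamma>: "\<Gamma> \<in> borel_measurable N"
    unfolding \<Gamma>_def
  proof (rule measurable_coordinatewise_then_product)
    show "(\<lambda>y. if i < k then C i y else 0) \<in> borel_measurable N" for i
      using C by (cases "i < k") auto
  qed
  have eq: "(\<lambda>t. \<Sum>i<k. C i y * v i t) = W (\<Gamma> y)" for y by (simp add: W_def \<Gamma>_def)
  have dist: "L2_dist M (W c) (W d) = sqrt (\<Sum>i<k. (c i - d i)\<^sup>2)" for c d
  proof -
    have "(\<lambda>t. W c t - W d t) = (\<lambda>t. \<Sum>i<k. (c i - d i) * v i t)"
      by (simp add: W_def sum_subtractf left_diff_distrib)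
    then show ?thesis
      using L2_inner_orthonormal_combination[OF on, of "\<lambda>i. c i - d i"] by (simp add: L2_dist_def L2_norm_eq)
  qed
  have "open (W -` U)" if U: "L2_open M U" for U
  proof (subst open_subopen, intro ballI)
    fix c assume "c \<in> W -` U"
    then have "\<exists>r>0. \<forall>h\<in>L2 M. L2_dist M (W c) h < r \<longrightarrow> h \<in> U"
      using U unfolding L2_open_def by simp
    then obtain r where r: "0 < r" "\<And>h. h \<in> L2 M \<Longrightarrow> L2_dist M (W c) h < r \<Longrightarrow> h \<in> U" by blast
    let ?T = "{d. (\<Sum>i<k. (c i - d i)\<^sup>2) < r\<^sup>2}"
    have "open ?T"
      by (intro open_Collect_less continuous_intros continuous_on_product_coordinates)
    moreover have "c \<in> ?T" using r by simp
    moreover have "?T \<subseteq> W -` U"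
    proof
      fix d assume "d \<in> ?T"
      then have "L2_dist M (W c) (W d) < r"
        unfolding dist using r(1) by (intro real_less_lsqrt) (auto intro: sum_nonneg)
      then show "d \<in> W -` U" using r(2)[OF W] by simp
    qed
    ultimately show "\<exists>T. open T \<and> c \<in> T \<and> T \<subseteq> W -` U" by blast
  qed
  then have "(\<lambda>y. W (\<Gamma> y)) -` U \<inter> space N \<in> sets N" if "L2_open M U" for U
    using measurable_sets[OF \<Gamma> borel_open, of "W -` U"] that by (simp add: vimage_def)
  then show ?thesis
    unfolding eq L2_borel_def using W
    by (intro measurable_measure_of) (auto simp: L2_open_def)
qed

lemma ennreal_sqrt_le:
  assumes "x \<le> ennreal c" "0 \<le> c"
  shows "ennreal_sqrt x \<le> ennreal (sqrt c)"
proof (cases x)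
  case (real r)
  then show ?thesis using assms by (simp add: ennreal_sqrt_def ennreal_le_iff)
next
  case top
  then show ?thesis using assms by (simp add: top_unique)
qed

text \<open>
  A scheme is run as a nonadaptive method: exactly \<open>n'\<close> values are computed, and the estimated
  coefficients define the output. The points after the first \<open>n'\<close> are never evaluated but must belong to the
  domain, whence \<open>x0\<close>.
\<close>

lemma e_ran_std_le:
  assumes M: "prob_space M" and F: "F \<subseteq> L2 M" and on: "orthonormal M k v"
    and cs: "coefficient_scheme M k v n' \<beta>" and \<beta>: "0 \<le> \<beta>" and n: "n' \<le> n" "n \<noteq> 0"
    and e: "\<And>f. f \<in> unit_ball F ip \<Longrightarrow> L2_norm M (residual M k v f) \<le> e" and e0: "0 \<le> e"
  shows "e_ran M F ip (info_std M) n \<le> ennreal (sqrt (1 + \<beta>) * e)"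
proof -
  interpret L: semi_inner "L2 M" "L2_inner M" by (rule semi_inner_L2)
  interpret M: prob_space M by (rule M)
  have v: "v i \<in> L2 M" if "i < k" for i using on that by (auto simp: orthonormal_def)
  have vv: "L2_inner M (v i) (v j) = (if i = j then 1 else 0)" if "i < k" "j < k" for i j
    using on that by (auto simp: orthonormal_def)
  obtain P h where Ph: "prob_space P \<and> sets P = sets (Pi\<^sub>M {..<n'} (\<lambda>_. M)) \<and>
       (\<forall>i<k. \<forall>j<n'. (\<lambda>x. h x i j) \<in> borel_measurable P) \<and>
       (\<forall>f\<in>L2 M. (\<integral>\<^sup>+x. ennreal (\<Sum>i<k. ((\<Sum>j<n'. h x i j * f (x j)) - L2_inner M f (v i))\<^sup>2) \<partial>P)
          \<le> ennreal (\<beta> * (L2_norm M (residual M k v f))\<^sup>2))"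
    using cs unfolding coefficient_scheme_def by (elim exE)
  have P: "prob_space P" and setsP: "sets P = sets (Pi\<^sub>M {..<n'} (\<lambda>_. M))"
    and h: "i < k \<Longrightarrow> j < n' \<Longrightarrow> (\<lambda>x. h x i j) \<in> borel_measurable P"
    and err: "f \<in> L2 M \<Longrightarrow> (\<integral>\<^sup>+x. ennreal (\<Sum>i<k. ((\<Sum>j<n'. h x i j * f (x j)) - L2_inner M f (v i))\<^sup>2) \<partial>P)
          \<le> ennreal (\<beta> * (L2_norm M (residual M k v f))\<^sup>2)" for i j f
    using Ph by auto
  interpret P: prob_space P by (rule P)
  obtain x0 where x0: "x0 \<in> space M" using M.not_empty by blast
  define c where "c f \<omega> i = (\<Sum>j<n'. h \<omega> i j * f (\<omega> j))" for f \<omega> i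
  define A where "A \<omega> = \<lparr>info = (\<lambda>j f. f (if j < n' then \<omega> j else x0)), stops = (\<lambda>a y. a = n'),
      output_map = (\<lambda>a y t. \<Sum>i<k. (\<Sum>j<a. h \<omega> i j * y j) * v i t)\<rparr>" for \<omega>
  have card: "cardinality (A \<omega>) f = n'" for \<omega> f by (auto simp: A_def cardinality_def intro: Least_equality)
  have run: "run (A \<omega>) f = (\<lambda>t. \<Sum>i<k. c f \<omega> i * v i t)" for \<omega> f
    unfolding run_def card by (simp add: A_def info_vec_def c_def)
  have dist: "L2_dist M f (run (A \<omega>) f) =
      sqrt ((L2_norm M (residual M k v f))\<^sup>2 + (\<Sum>i<k. (c f \<omega> i - L2_inner M f (v i))\<^sup>2))"
    if f: "f \<in> L2 M" for \<omega> f
  proof -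
    have "(L2_dist M f (run (A \<omega>) f))\<^sup>2 =
        (L2_norm M (residual M k v f))\<^sup>2 + (\<Sum>i<k. (c f \<omega> i - L2_inner M f (v i))\<^sup>2)"
      unfolding run L2_dist_def L2_norm_power2 residual_def
      by (rule L.Pythagoras) (use v vv f in auto)
    moreover have "0 \<le> L2_dist M f (run (A \<omega>) f)" by (simp add: L2_dist_def L2_norm_def)
    ultimately show ?thesis by (metis real_sqrt_unique)
  qed
  have cm: "(\<lambda>\<omega>. c f \<omega> i) \<in> borel_measurable P" if f: "f \<in> L2 M" and i: "i < k" for f i
    unfolding c_def
  proof (rule borel_measurable_sum)
    fix j assume "j \<in> {..<n'}"
    then show "(\<lambda>x. h x i j * f (x j)) \<in> borel_measurable P"
      using h[OF i] coordinate_measurable[of f M j n'] f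
      by (intro borel_measurable_times) (auto simp: measurable_cong_sets[OF setsP refl] L2_def)
  qed
  have det: "is_det_method M F (info_std M) (A \<omega>)" if \<omega>: "\<omega> \<in> space P" for \<omega>
    unfolding is_det_method_def
  proof (intro conjI allI ballI)
    fix j
    have "(if j < n' then \<omega> j else x0) \<in> space M"
      using \<omega> x0 sets_eq_imp_space_eq[OF setsP] by (auto simp: space_PiM)
    then show "info (A \<omega>) j \<in> info_std M" by (auto simp: A_def info_std_def)
  next
    fix a
    have "(\<lambda>y t. \<Sum>i<k. (\<Sum>j<a. h \<omega> i j * y j) * v i t) \<in> measurable (real_pow a) (L2_borel M)"
      by (rule orthonormal_combination_measurable[OF on]) simp
    then show "output_map (A \<omega>) a \<in> measurable (real_pow a) (L2_borel M)" by (simp add: A_def)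
  next
    fix f
    show "\<exists>a. stops (A \<omega>) a (info_vec (info (A \<omega>)) a f)" by (simp add: A_def)
  qed
  have ran: "is_ran_method M F (info_std M) P A"
    unfolding is_ran_method_def
  proof (intro conjI ballI)
    fix f assume "f \<in> F"
    then have f: "f \<in> L2 M" using F by auto
    show "(\<lambda>\<omega>. L2_dist M f (run (A \<omega>) f)) \<in> borel_measurable P"
      unfolding dist[OF f] using cm[OF f]
      by (intro measurable_compose[OF _ borel_measurable_sqrt] borel_measurable_add
        borel_measurable_sum borel_measurable_power borel_measurable_diff) auto
  qed (auto simp: card P det)
  have rc: "ran_card F ip P A \<le> of_nat n"
    unfolding ran_card_def card using n by (intro SUP_least) (simp add: P.emeasure_space_1)
  have "ran_error M F ip P A \<le> ennreal (sqrt ((1 + \<beta>) * e\<^sup>2))"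
    unfolding ran_error_def
  proof (intro SUP_least ennreal_sqrt_le)
    fix f assume fb: "f \<in> unit_ball F ip"
    then have f: "f \<in> L2 M" using F by (auto simp: unit_ball_def)
    let ?r = "(L2_norm M (residual M k v f))\<^sup>2"
    have r: "?r \<le> e\<^sup>2" using e[OF fb] by (intro power_mono) (auto simp: L2_norm_def)
    have "(\<integral>\<^sup>+\<omega>. ennreal ((L2_dist M f (run (A \<omega>) f))\<^sup>2) \<partial>P) =
        (\<integral>\<^sup>+\<omega>. ennreal ?r + ennreal (\<Sum>i<k. (c f \<omega> i - L2_inner M f (v i))\<^sup>2) \<partial>P)"
      unfolding dist[OF f] by (intro nn_integral_cong) (simp add: sum_nonneg)
    also have "\<dots> = ennreal ?r + (\<integral>\<^sup>+\<omega>. ennreal (\<Sum>i<k. (c f \<omega> i - L2_inner M f (v i))\<^sup>2) \<partial>P)"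
      using cm[OF f] by (subst nn_integral_add) (auto simp: P.emeasure_space_1)
    also have "\<dots> \<le> ennreal ?r + ennreal (\<beta> * ?r)"
      unfolding c_def by (intro add_left_mono err[OF f])
    also have "\<dots> = ennreal ((1 + \<beta>) * ?r)"
      using \<beta> by (simp add: ring_distribs flip: ennreal_plus)
    also have "\<dots> \<le> ennreal ((1 + \<beta>) * e\<^sup>2)"
      using r \<beta> by (intro ennreal_leI mult_left_mono) auto
    finally show "(\<integral>\<^sup>+\<omega>. ennreal ((L2_dist M f (run (A \<omega>) f))\<^sup>2) \<partial>P) \<le> ennreal ((1 + \<beta>) * e\<^sup>2)" .
  qed (use \<beta> in auto)
  also have "sqrt ((1 + \<beta>) * e\<^sup>2) = sqrt (1 + \<beta>) * e" using e0 by (simp add: real_sqrt_mult)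
  finally show ?thesis using e_ran_le[OF ran rc n(2)] by (rule order_trans[rotated])
qed

lemma prob_space_weighted_measure:
  assumes "weighted_domain d D \<rho>"
  shows "prob_space (weighted_measure d D \<rho>)"
proof (rule prob_spaceI)
  let ?R = "restrict_space (lebesgue_pow d) D"
  have "(\<lambda>x. ennreal (\<rho> x)) \<in> borel_measurable ?R"
    using assms unfolding weighted_domain_def
    by (intro measurable_compose[OF _ measurable_ennreal]) blast
  then have "emeasure (density ?R (\<lambda>x. ennreal (\<rho> x))) (space ?R) =
      (\<integral>\<^sup>+x. ennreal (\<rho> x) * indicator (space ?R) x \<partial>?R)"
    by (rule emeasure_density) (rule sets.top)
  also have "\<dots> = (\<integral>\<^sup>+x. ennreal (\<rho> x) \<partial>?R)" by (intro nn_integral_cong) (simp add: indicator_def)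
  also have "\<dots> = 1" using assms by (simp add: weighted_domain_def)
  finally show "emeasure (weighted_measure d D \<rho>) (space (weighted_measure d D \<rho>)) = 1"
    unfolding weighted_measure_def space_density .
qed

text \<open>
  The infimum defining the worst case error need not be attained. This is harmless, as the number \<open>n\<close>
  of points is the same for all algorithms of cardinality \<open>m\<close>; only the scheme depends on the algorithm.
\<close>

lemma e_ran_std_le_e_wor_all:
  assumes M: "prob_space M" and H: "compactly_embedded_Hilbert_space M F ip"
    and m: "m \<noteq> 0" and n: "n \<noteq> 0" and \<beta>: "0 \<le> \<beta>"
    and scheme: "\<And>k v. k \<le> m \<Longrightarrow> orthonormal M k v \<Longrightarrow> \<exists>n'\<le>n. coefficient_scheme M k v n' \<beta>"
  shows "e_ran M F ip (info_std M) n \<le> ennreal (sqrt (1 + \<beta>)) * e_wor M F ip (info_all F) m"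
proof -
  let ?C = "ennreal (sqrt (1 + \<beta>))"
  have C: "0 < sqrt (1 + \<beta>)" using \<beta> by simp
  have F: "F \<subseteq> L2 M" using H by (auto simp: compactly_embedded_Hilbert_space_def compactly_embedded_def)
  have *: "e_ran M F ip (info_std M) n \<le> ?C * wor_error M F ip (\<lambda>f. \<phi> (info_vec L m f))"
    if L: "\<forall>j<m. L j \<in> info_all F" and \<phi>: "\<phi> \<in> measurable (real_pow m) (L2_borel M)" for L \<phi>
  proof (cases "wor_error M F ip (\<lambda>f. \<phi> (info_vec L m f))")
    case top
    then show ?thesis using C by (simp add: ennreal_mult_top)
  next
    case (real e)
    have err: "L2_dist M f (\<phi> (info_vec L m f)) \<le> e" if "f \<in> unit_ball F ip" for f
    proof -
      have "ennreal (L2_dist M f (\<phi> (info_vec L m f))) \<le> wor_error M F ip (\<lambda>f. \<phi> (info_vec L m f))"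
        unfolding wor_error_def by (rule SUP_upper[OF that])
      then show ?thesis using real by simp
    qed
    obtain k v where kv: "k \<le> m \<and> orthonormal M k v \<and>
        (\<forall>f\<in>unit_ball F ip. L2_norm M (residual M k v f) \<le> e)"
      using subspace_from_worst_case_algorithm[OF H _ \<phi> err] L by blast
    obtain n' where n': "n' \<le> n" "coefficient_scheme M k v n' \<beta>" using scheme kv by blast
    have "e_ran M F ip (info_std M) n \<le> ennreal (sqrt (1 + \<beta>) * e)"
      using kv n' by (intro e_ran_std_le[OF M F _ n'(2) \<beta> _ n _ real(1)]) auto
    then show ?thesis using real C by (simp add: ennreal_mult')
  qed
  have "e_ran M F ip (info_std M) n / ?C \<le> e_wor M F ip (info_all F) m"
    unfolding e_wor_def using m
  proof (simp only: if_False, intro INF_greatest, clarify)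
    fix L \<phi> assume L: "\<forall>j<m. L j \<in> info_all F" and \<phi>: "\<phi> \<in> measurable (real_pow m) (L2_borel M)"
    show "e_ran M F ip (info_std M) n / ?C \<le> wor_error M F ip (\<lambda>f. \<phi> (info_vec L m f))"
      using *[OF L \<phi>] C by (intro divide_le_posI_ennreal) auto
  qed
  then have "?C * (e_ran M F ip (info_std M) n / ?C) \<le> ?C * e_wor M F ip (info_all F) m"
    by (intro mult_left_mono) auto
  also have "?C * (e_ran M F ip (info_std M) n / ?C) = e_ran M F ip (info_std M) n"
    using C by (simp add: ennreal_times_divide mult.commute[of ?C] ennreal_mult_divide_eq)
  finally show ?thesis .
qed

section \<open>Information complexity\<close>

lemma info_complexity_le:
  "e n \<le> ennreal \<epsilon> * cri crit e \<Longrightarrow> info_complexity crit e \<epsilon> \<le> enat n"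
  unfolding info_complexity_def by (intro INF_lower) simp

lemma info_complexity_attained:
  assumes "info_complexity crit e \<epsilon> = enat n"
  shows "e n \<le> ennreal \<epsilon> * cri crit e"
proof -
  let ?S = "enat ` {n. e n \<le> ennreal \<epsilon> * cri crit e}"
  have eq: "Inf ?S = enat n" using assms by (simp add: info_complexity_def)
  have ne: "?S \<noteq> {}"
  proof
    assume "?S = {}"
    then have "Inf ?S = \<infinity>" by (simp add: Inf_enat_def)
    then show False using eq by simp
  qed
  then obtain x where "x \<in> ?S" by blast
  then have "(LEAST x. x \<in> ?S) \<in> ?S" by (rule LeastI)
  then have "Inf ?S \<in> ?S" using ne by (simp only: Inf_enat_def if_False)
  then show ?thesis using eq by auto
qed

text \<open>
  The error criteria of both settings refer to the same quantity, because the initial errors coincide. For \<open>m = 0\<close> the zero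
  algorithm is compared with itself.
\<close>

lemma n_ran_std_le:
  fixes b :: "real \<Rightarrow> real"
  assumes M: "prob_space M" and H: "compactly_embedded_Hilbert_space M F ip"
    and \<epsilon>: "0 < \<epsilon>" and A: "1 \<le> A" and \<beta>: "0 \<le> \<beta>" "sqrt (1 + \<beta>) \<le> A"
    and b0: "0 \<le> b 0"
    and scheme: "\<And>m. m \<noteq> 0 \<Longrightarrow> \<exists>n. n \<noteq> 0 \<and> real n \<le> b (real m) \<and>
      (\<forall>k v. k \<le> m \<longrightarrow> orthonormal M k v \<longrightarrow> (\<exists>n'\<le>n. coefficient_scheme M k v n' \<beta>))"
  shows "ereal_of_enat (n_ran_std M F ip crit \<epsilon>) \<le> at_enat b (n_wor_all M F ip crit (\<epsilon> / A))"
proof (cases "n_wor_all M F ip crit (\<epsilon> / A)")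
  case infinity
  then show ?thesis by (simp add: at_enat_def)
next
  case (enat m)
  let ?ew = "e_wor M F ip (info_all F)" and ?er = "e_ran M F ip (info_std M)"
  have cri: "cri crit ?er = cri crit ?ew" by (cases crit) (simp_all add: e_ran_def e_wor_def)
  have em: "?ew m \<le> ennreal (\<epsilon> / A) * cri crit ?ew"
    using enat unfolding n_wor_all_def by (rule info_complexity_attained)
  have "\<exists>n. real n \<le> b (real m) \<and> ?er n \<le> ennreal \<epsilon> * cri crit ?ew"
  proof (cases "m = 0")
    case True
    have "?er 0 = ?ew 0" by (simp add: e_ran_def e_wor_def)
    also have "\<dots> \<le> ennreal (\<epsilon> / A) * cri crit ?ew" using em True by simp
    also have "\<dots> \<le> ennreal \<epsilon> * cri crit ?ew"
      using \<epsilon> A by (intro mult_right_mono ennreal_leI) (auto simp: field_simps)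
    finally show ?thesis using True b0 by (intro exI[of _ 0]) simp
  next
    case False
    then obtain n where n: "n \<noteq> 0" "real n \<le> b (real m)"
      and sch: "\<And>k v. k \<le> m \<Longrightarrow> orthonormal M k v \<Longrightarrow> \<exists>n'\<le>n. coefficient_scheme M k v n' \<beta>"
      using scheme by blast
    have "?er n \<le> ennreal (sqrt (1 + \<beta>)) * ?ew m"
      by (rule e_ran_std_le_e_wor_all[OF M H False n(1) \<beta>(1) sch])
    also have "\<dots> \<le> ennreal A * (ennreal (\<epsilon> / A) * cri crit ?ew)"
      using em \<beta> by (intro mult_mono ennreal_leI) auto
    also have "\<dots> = ennreal \<epsilon> * cri crit ?ew"
      using A \<epsilon> by (simp add: mult.assoc[symmetric] flip: ennreal_mult')
    finally show ?thesis using n by blast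
  qed
  then obtain n where n: "real n \<le> b (real m)" "?er n \<le> ennreal \<epsilon> * cri crit ?er"
    unfolding cri by blast
  have "ereal_of_enat (n_ran_std M F ip crit \<epsilon>) \<le> ereal_of_enat (enat n)"
    unfolding n_ran_std_def ereal_of_enat_le_iff by (rule info_complexity_le[OF n(2)])
  also have "\<dots> \<le> at_enat b (n_wor_all M F ip crit (\<epsilon> / A))"
    using n(1) enat by (simp add: at_enat_def)
  finally show ?thesis .
qed

lemma constant_factor_count:
  assumes "m \<noteq> 0"
  shows "real (m + nat \<lceil>ln (real m + 1)\<rceil> * (3 * m)) \<le> (real m + 1) * (3 * ln (real m + 1) + 4)"
proof -
  have l: "0 \<le> ln (real m + 1)" by simp
  then have "real (nat \<lceil>ln (real m + 1)\<rceil>) \<le> ln (real m + 1) + 1" by linarith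
  moreover have "1 + 3 * x \<le> 1 + 3 * y" if "x \<le> y" for x y :: real using that by simp
  ultimately have "1 + 3 * real (nat \<lceil>ln (real m + 1)\<rceil>) \<le> 1 + 3 * (ln (real m + 1) + 1)" by blast
  then have "real m * (1 + 3 * real (nat \<lceil>ln (real m + 1)\<rceil>)) \<le> real m * (1 + 3 * (ln (real m + 1) + 1))"
    by (rule mult_left_mono) simp
  also have "\<dots> \<le> (real m + 1) * (3 * ln (real m + 1) + 4)"
    using l by (simp add: algebra_simps)
  finally show ?thesis by (simp add: algebra_simps)
qed

lemma constant_factor_bound:
  fixes N :: real
  assumes "0 \<le> N"
  shows "(N + 1) * (3 * ln (N + 1) + 4) \<le> 96 * sqrt 2 * (N + 1) * (ln (N + 1) + ln (192 * sqrt 2))"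
proof -
  have s2: "1 \<le> sqrt (2::real)" by simp
  have "exp 1 \<le> (3::real)" by (rule exp_le)
  also have "\<dots> \<le> 192 * sqrt 2" using s2 by linarith
  finally have "1 \<le> ln (192 * sqrt (2::real))" by (subst ln_ge_iff) auto
  moreover have l: "0 \<le> ln (N + 1)" using assms by simp
  moreover have "3 * x + 4 \<le> 96 * (x + y)" if "1 \<le> y" "0 \<le> x" for x y :: real using that by simp
  ultimately have "3 * ln (N + 1) + 4 \<le> 96 * (ln (N + 1) + ln (192 * sqrt 2))" by blast
  also have "\<dots> \<le> 96 * sqrt 2 * (ln (N + 1) + ln (192 * sqrt 2))"
    using l \<open>1 \<le> ln (192 * sqrt 2)\<close> by (intro mult_right_mono) auto
  finally have "(N + 1) * (3 * ln (N + 1) + 4) \<le> (N + 1) * (96 * sqrt 2 * (ln (N + 1) + ln (192 * sqrt 2)))"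
    using assms by (intro mult_left_mono) auto
  then show ?thesis by (simp only: mult_ac)
qed

lemma near_optimal_count:
  assumes "m \<noteq> 0" "0 < L"
  shows "real (m + nat \<lceil>ln (real m + 1)\<rceil> * (3 * m) + nat \<lceil>30 * L\<rceil> * m)
    \<le> (real m + 1) * (3 * ln (real m + 1) + 30 * L + 5)"
proof -
  have "real (nat \<lceil>30 * L\<rceil>) \<le> 30 * L + 1" using assms(2) by linarith
  then have "real (nat \<lceil>30 * L\<rceil>) * real m \<le> (30 * L + 1) * (real m + 1)"
    using assms(2) by (intro mult_mono) auto
  then show ?thesis using constant_factor_count[OF assms(1)] by (simp add: algebra_simps)
qed

lemma near_optimal_bound:
  fixes N L :: real
  assumes N: "0 \<le> N" and L: "1 \<le> L"
  shows "(N + 1) * (3 * ln (N + 1) + 30 * L + 5) \<le> 48 * (4 * (ln 48 + ln L + ln (N + 1)) + L) * (N + 1)"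
proof -
  have "exp 1 \<le> (48::real)" using exp_le by linarith
  then have "1 \<le> ln (48::real)" by (subst ln_ge_iff) auto
  moreover have "0 \<le> ln (N + 1)" "0 \<le> ln L" using N L by auto
  moreover have "3 * x + 30 * L + 5 \<le> 48 * (4 * (y + z + x) + L)" if "1 \<le> y" "0 \<le> x" "0 \<le> z" for x y z
    using that L by simp
  ultimately have "3 * ln (N + 1) + 30 * L + 5 \<le> 48 * (4 * (ln 48 + ln L + ln (N + 1)) + L)"
    by blast
  then have "(N + 1) * (3 * ln (N + 1) + 30 * L + 5) \<le> (N + 1) * (48 * (4 * (ln 48 + ln L + ln (N + 1)) + L))"
    using N by (intro mult_left_mono) auto
  then show ?thesis by (simp only: mult_ac)
qed

section \<open>The complexity bounds\<close>

theorem theorem2p3: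
  shows "(\<forall>D \<rho> F ip. approximation_problems D \<rho> F ip \<longrightarrow>
      (\<forall>crit. \<forall>d\<ge>1. \<forall>\<epsilon>\<in>{0<..<1::real}.
        ereal_of_enat (n_ran_std (weighted_measure d (D d) (\<rho> d)) (F d) (ip d) crit \<epsilon>)
        \<le> at_enat (\<lambda>N. 96 * sqrt 2 * (N + 1) * (ln (N + 1) + ln (192 * sqrt 2)))
            (n_wor_all (weighted_measure d (D d) (\<rho> d)) (F d) (ip d) crit (\<epsilon> / 4))))
    \<and>
    (\<exists>\<delta>0\<in>{0<..<1::real}. \<forall>\<delta>\<in>{0<..<\<delta>0}.
      \<forall>D \<rho> F ip. approximation_problems D \<rho> F ip \<longrightarrow>
      (\<forall>crit. \<forall>d\<ge>1. \<forall>\<epsilon>\<in>{0<..<1::real}.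
        ereal_of_enat (n_ran_std (weighted_measure d (D d) (\<rho> d)) (F d) (ip d) crit \<epsilon>)
        \<le> at_enat (\<lambda>N. 48 * (4 * (ln 48 + ln (ln (1 / \<delta>)) + ln (N + 1)) + ln (1 / \<delta>)) * (N + 1))
            (n_wor_all (weighted_measure d (D d) (\<rho> d)) (F d) (ip d) crit (\<epsilon> / A_const \<delta>))))"
proof (intro conjI allI impI ballI)
  fix D :: "nat \<Rightarrow> (nat \<Rightarrow> real) set" and \<rho> F ip crit and d :: nat and \<epsilon> :: real
  assume AP: "approximation_problems D \<rho> F ip" and d: "1 \<le> d" and \<epsilon>: "\<epsilon> \<in> {0<..<1}"
  let ?M = "weighted_measure d (D d) (\<rho> d)"
  have M: "prob_space ?M" and H: "compactly_embedded_Hilbert_space ?M (F d) (ip d)"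
    using AP d by (auto simp: approximation_problems_def intro: prob_space_weighted_measure)
  show "ereal_of_enat (n_ran_std ?M (F d) (ip d) crit \<epsilon>)
      \<le> at_enat (\<lambda>N. 96 * sqrt 2 * (N + 1) * (ln (N + 1) + ln (192 * sqrt 2)))
          (n_wor_all ?M (F d) (ip d) crit (\<epsilon> / 4))"
  proof (rule n_ran_std_le[OF M H, where \<beta> = "3 / 2"])
    show "sqrt (1 + 3 / 2) \<le> (4::real)" by (rule real_le_lsqrt) auto
    show "0 \<le> 96 * sqrt 2 * (0 + 1) * (ln (0 + 1) + ln (192 * sqrt (2::real)))"
      using constant_factor_bound[of 0] by simp
  next
    fix m :: nat assume m: "m \<noteq> 0"
    have "real (m + nat \<lceil>ln (real m + 1)\<rceil> * (3 * m))
        \<le> 96 * sqrt 2 * (real m + 1) * (ln (real m + 1) + ln (192 * sqrt 2))"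
      using constant_factor_count[OF m] constant_factor_bound[of "real m"] by linarith
    then show "\<exists>n. n \<noteq> 0 \<and> real n \<le> 96 * sqrt 2 * (real m + 1) * (ln (real m + 1) + ln (192 * sqrt 2)) \<and>
        (\<forall>k v. k \<le> m \<longrightarrow> orthonormal ?M k v \<longrightarrow> (\<exists>n'\<le>n. coefficient_scheme ?M k v n' (3 / 2)))"
      using m constant_factor_scheme[OF M] by (intro exI[of _ "m + nat \<lceil>ln (real m + 1)\<rceil> * (3 * m)"]) auto
  qed (use \<epsilon> in auto)
next
  show "\<exists>\<delta>0\<in>{0<..<1::real}. \<forall>\<delta>\<in>{0<..<\<delta>0}.
      \<forall>D \<rho> F ip. approximation_problems D \<rho> F ip \<longrightarrow>
      (\<forall>crit. \<forall>d\<ge>1. \<forall>\<epsilon>\<in>{0<..<1::real}.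
        ereal_of_enat (n_ran_std (weighted_measure d (D d) (\<rho> d)) (F d) (ip d) crit \<epsilon>)
        \<le> at_enat (\<lambda>N. 48 * (4 * (ln 48 + ln (ln (1 / \<delta>)) + ln (N + 1)) + ln (1 / \<delta>)) * (N + 1))
            (n_wor_all (weighted_measure d (D d) (\<rho> d)) (F d) (ip d) crit (\<epsilon> / A_const \<delta>)))"
  proof (rule bexI[of _ "exp (- 1)"], intro ballI allI impI)
    fix \<delta> \<epsilon> :: real and D :: "nat \<Rightarrow> (nat \<Rightarrow> real) set" and \<rho> F ip crit and d :: nat
    assume \<delta>: "\<delta> \<in> {0<..<exp (- 1)}" and AP: "approximation_problems D \<rho> F ip" and d: "1 \<le> d"
      and \<epsilon>: "\<epsilon> \<in> {0<..<1}"
    let ?M = "weighted_measure d (D d) (\<rho> d)"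
    have M: "prob_space ?M" and H: "compactly_embedded_Hilbert_space ?M (F d) (ip d)"
      using AP d by (auto simp: approximation_problems_def intro: prob_space_weighted_measure)
    define L where "L = ln (1 / \<delta>)"
    have \<delta>0: "0 < \<delta>" and "\<delta> < exp (- 1)" using \<delta> by auto
    then have "ln \<delta> < - 1" by (metis ln_exp ln_less_cancel_iff exp_gt_zero)
    then have L: "1 \<le> L" using \<delta>0 by (simp add: L_def ln_div)
    have \<delta>1: "\<delta> < 1" using \<open>\<delta> < exp (- 1)\<close> by (smt (verit) exp_le_one_iff)
    have A: "sqrt (1 + 1 / (12 * L)) \<le> A_const \<delta>"
    proof -
      have "1 \<le> 1 / sqrt (1 - \<delta>)" using \<delta>0 \<delta>1 by simp
      then have "sqrt (1 + 1 / (12 * L)) * 1 \<le> sqrt (1 + 1 / (12 * L)) * (1 / sqrt (1 - \<delta>))"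
        using L by (intro mult_left_mono) auto
      then show ?thesis unfolding A_const_def L_def[symmetric] by (simp only: mult_1_right)
    qed
    have A1: "1 \<le> A_const \<delta>" using A L by (intro order_trans[OF _ A]) auto
    show "ereal_of_enat (n_ran_std ?M (F d) (ip d) crit \<epsilon>)
        \<le> at_enat (\<lambda>N. 48 * (4 * (ln 48 + ln (ln (1 / \<delta>)) + ln (N + 1)) + ln (1 / \<delta>)) * (N + 1))
            (n_wor_all ?M (F d) (ip d) crit (\<epsilon> / A_const \<delta>))"
      unfolding L_def[symmetric]
    proof (rule n_ran_std_le[OF M H _ A1 _ A])
      show "0 \<le> 48 * (4 * (ln 48 + ln L + ln (0 + 1)) + L) * (0 + 1)"
        using near_optimal_bound[of 0 L] L by simp
    next
      fix m :: nat assume m: "m \<noteq> 0"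
      have L0: "0 < L" using L by simp
      let ?n = "m + nat \<lceil>ln (real m + 1)\<rceil> * (3 * m) + nat \<lceil>30 * L\<rceil> * m"
      have "real ?n \<le> 48 * (4 * (ln 48 + ln L + ln (real m + 1)) + L) * (real m + 1)"
        using near_optimal_count[OF m L0] near_optimal_bound[of "real m" L] L by linarith
      then show "\<exists>n. n \<noteq> 0 \<and> real n \<le> 48 * (4 * (ln 48 + ln L + ln (real m + 1)) + L) * (real m + 1) \<and>
          (\<forall>k v. k \<le> m \<longrightarrow> orthonormal ?M k v \<longrightarrow> (\<exists>n'\<le>n. coefficient_scheme ?M k v n' (1 / (12 * L))))"
        using m near_optimal_scheme[OF M _ _ L0] by (intro exI[of _ ?n]) auto
    qed (use \<epsilon> L in auto)
  qed simp
qed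

end
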